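(* Let $V,W$ be finite-dimensional vector spaces over $\mathbb{K}\in\{\mathbb{R},\mathbb{C}\}$, let $(V,\mu)$ and $(W,\nu)$ be Lie algebras and let $f:(V,\mu)\to(W,\nu)$ be a morphism of Lie algebras. Assume that $$H^2_{CE}\left(\mathrm{graph}(f),\frac{V\oplus W}{\mathrm{graph}(f)}\right)=0.$$ Then for every open neighborhood $\mathcal{N}$ of $f$ in the space of linear maps $V\to W$ there is an open neighborhood $\mathcal{U}$ of $\mu\oplus\nu$ in the set of Lie algebra structures on $V\oplus W$ such that for every $M\in\mathcal{U}$ there is a family of linear maps $f'\in\mathcal{N}$, parametrized by an open neighborhood of $0\in\mathrm{Der}\left(\mathrm{graph}(f),\frac{V\oplus W}{\mathrm{graph}(f)}\right)$, such that for each $f'$ in the family $\mathrm{graph}(f')\subseteq(V\oplus W,M)$ is a Lie subalgebra. In particular, when $M=\mu'\oplus\nu'$ for Lie algebra structures $\mu'$ on $V$ and $\nu'$ on $W$, each such $f':(V,\mu')\to(W,\nu')$ is a Lie algebra morphism.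
   Context: A Lie algebra structure on a vector space $E$ is an element of $\wedge^2E^\ast\otimes E$, viewed as a linear map $\wedge^2E\to E$, satisfying the Jacobi identity; the set of Lie algebra structures has the subspace topology. $\mu\oplus\nu$ is the direct product Lie algebra structure on $V\oplus W$. For a linear map $f:V\to W$, $\mathrm{graph}(f)=\{(v,f(v)):v\in V\}\subseteq V\oplus W$; since $f$ is a Lie algebra morphism, $\mathrm{graph}(f)$ is a Lie subalgebra of $(V\oplus W,\mu\oplus\nu)$ and is regarded as a Lie algebra with the restricted bracket. It acts on $(V\oplus W)/\mathrm{graph}(f)$ by the representation induced by the bracket $\mu\oplus\nu$. For a Lie algebra $L$ and representation $\rho:L\to\mathrm{End}(E)$, $H^\bullet_{CE}(L,E)$ is the standard Chevalley–Eilenberg cohomology of $L$ with values in $E$, and $\mathrm{Der}(L,E)$ is the space of $E$-valued derivations, i.e. linear maps $\delta:L\to E$ with $\delta([x,y])=\rho(x)\delta(y)-\rho(y)\delta(x)$. A family in a set $X$ parametrized by $O$ is a map $O\to X$. *)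

theory Defs
  imports "HOL-Analysis.Analysis" "HOL-Algebra.AbelCoset" "HOL-Algebra.Module"
begin

text \<open>
  The ground field is a type of sort \<open>{real_normed_field, euclidean_space}\<close>: a field extension of
  the reals of finite degree with a multiplicative norm. Both \<open>real\<close> and \<open>complex\<close> have this sort,
  and every type of this sort is isomorphic to one of them.

  The vector spaces \<open>V\<close> and \<open>W\<close> are types with an explicit scalar multiplication (locale
  \<open>finite_dimensional_vector_space\<close>). Spaces built from them (subspaces, quotients, spaces of maps)
  do not fill a type, or not with the operations of the type, and are given by records of type
  \<open>('k, 'a) module\<close> from HOL-Algebra, whose multiplicative part is never used. The members of a space
  of maps are extensional, so that maps agreeing on the domain are equal.
\<close>


section \<open>Vector spaces, linear maps, quotients\<close>

definition vspace_on :: "('k \<Rightarrow> 'a \<Rightarrow> 'a) \<Rightarrow> 'a::ab_group_add set \<Rightarrow> ('k, 'a) module" where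
  "vspace_on s S =
     \<lparr>carrier = S, mult = undefined, one = undefined, zero = 0, add = (+), smult = s\<rparr>"

definition fun_space :: "'a set \<Rightarrow> ('k, 'b) module \<Rightarrow> ('a \<Rightarrow> 'b) set \<Rightarrow> ('k, 'a \<Rightarrow> 'b) module" where
  "fun_space D E F =
     \<lparr>carrier = F, mult = undefined, one = undefined,
      zero = (\<lambda>x\<in>D. \<zero>\<^bsub>E\<^esub>),
      add = (\<lambda>f g. \<lambda>x\<in>D. f x \<oplus>\<^bsub>E\<^esub> g x),
      smult = (\<lambda>c f. \<lambda>x\<in>D. c \<odot>\<^bsub>E\<^esub> f x)\<rparr>"

definition lin_maps :: "('k, 'a) module \<Rightarrow> ('k, 'b) module \<Rightarrow> ('a \<Rightarrow> 'b) set" where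
  "lin_maps V W =
     {f \<in> carrier V \<rightarrow>\<^sub>E carrier W.
        (\<forall>x\<in>carrier V. \<forall>y\<in>carrier V. f (x \<oplus>\<^bsub>V\<^esub> y) = f x \<oplus>\<^bsub>W\<^esub> f y) \<and>
        (\<forall>c. \<forall>x\<in>carrier V. f (c \<odot>\<^bsub>V\<^esub> x) = c \<odot>\<^bsub>W\<^esub> f x)}"

definition Hom_space :: "('k, 'a) module \<Rightarrow> ('k, 'b) module \<Rightarrow> ('k, 'a \<Rightarrow> 'b) module" where
  "Hom_space V W = fun_space (carrier V) W (lin_maps V W)"

text \<open>\<open>c \<cdot> (a + S) = c a + S\<close>, also for \<open>c = 0\<close>.\<close>

definition quotient_space :: "('k, 'a) module \<Rightarrow> 'a set \<Rightarrow> ('k, 'a set) module" where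
  "quotient_space V S =
     \<lparr>carrier = a_rcosets\<^bsub>V\<^esub> S, mult = undefined, one = undefined,
      zero = S, add = set_add V, smult = (\<lambda>c A. \<Union>a\<in>A. S +>\<^bsub>V\<^esub> (c \<odot>\<^bsub>V\<^esub> a))\<rparr>"

text \<open>
  The initial topology for the linear functionals. If \<open>V\<close> is finite-dimensional, this is the usual
  topology: in coordinates with respect to any basis it is the topology of \<open>K\<^sup>n\<close>.
\<close>

definition vs_topology ::
    "('k::{real_normed_field, euclidean_space}, 'a) module \<Rightarrow> 'a topology" where
  "vs_topology V = topology_generated_by
     {{x \<in> carrier V. \<phi> x \<in> U} | \<phi> U. \<phi> \<in> lin_maps V (vspace_on (*) UNIV) \<and> open U}"


section \<open>Lie algebra structures\<close>

definition alt_bilinear :: "('k::field \<Rightarrow> 'a \<Rightarrow> 'a) \<Rightarrow> ('a::ab_group_add \<Rightarrow> 'a \<Rightarrow> 'a) set" where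
  "alt_bilinear s =
     {m. (\<forall>x. Vector_Spaces.linear s s (m x)) \<and>
         (\<forall>y. Vector_Spaces.linear s s (\<lambda>x. m x y)) \<and>
         (\<forall>x. m x x = 0)}"

definition lie_structures :: "('k::field \<Rightarrow> 'a \<Rightarrow> 'a) \<Rightarrow> ('a::ab_group_add \<Rightarrow> 'a \<Rightarrow> 'a) set" where
  "lie_structures s =
     {m \<in> alt_bilinear s. \<forall>x y z. m x (m y z) + m y (m z x) + m z (m x y) = 0}"

definition alt_bilinear_space ::
    "('k::field \<Rightarrow> 'a \<Rightarrow> 'a) \<Rightarrow> ('k, 'a::ab_group_add \<Rightarrow> 'a \<Rightarrow> 'a) module" where
  "alt_bilinear_space s =
     fun_space UNIV (fun_space UNIV (vspace_on s UNIV) UNIV) (alt_bilinear s)"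

definition lie_topology ::
    "('k::{real_normed_field, euclidean_space} \<Rightarrow> 'a \<Rightarrow> 'a) \<Rightarrow> ('a::ab_group_add \<Rightarrow> 'a \<Rightarrow> 'a) topology"
    where
  "lie_topology s = subtopology (vs_topology (alt_bilinear_space s)) (lie_structures s)"

definition lie_prod :: "('a \<Rightarrow> 'a \<Rightarrow> 'a) \<Rightarrow> ('b \<Rightarrow> 'b \<Rightarrow> 'b) \<Rightarrow> 'a \<times> 'b \<Rightarrow> 'a \<times> 'b \<Rightarrow> 'a \<times> 'b" where
  "lie_prod \<mu> \<nu> p q = (\<mu> (fst p) (fst q), \<nu> (snd p) (snd q))"

definition lie_morphism ::
    "('k::field \<Rightarrow> 'a::ab_group_add \<Rightarrow> 'a) \<Rightarrow> ('k \<Rightarrow> 'b::ab_group_add \<Rightarrow> 'b) \<Rightarrow>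
     ('a \<Rightarrow> 'a \<Rightarrow> 'a) \<Rightarrow> ('b \<Rightarrow> 'b \<Rightarrow> 'b) \<Rightarrow> ('a \<Rightarrow> 'b) \<Rightarrow> bool" where
  "lie_morphism sV sW \<mu> \<nu> f \<longleftrightarrow>
     Vector_Spaces.linear sV sW f \<and> (\<forall>x y. f (\<mu> x y) = \<nu> (f x) (f y))"

definition lie_subalgebra ::
    "('k::field \<Rightarrow> 'a::ab_group_add \<Rightarrow> 'a) \<Rightarrow> ('a \<Rightarrow> 'a \<Rightarrow> 'a) \<Rightarrow> 'a set \<Rightarrow> bool" where
  "lie_subalgebra s m S \<longleftrightarrow> module.subspace s S \<and> (\<forall>x\<in>S. \<forall>y\<in>S. m x y \<in> S)"

definition lin_graph :: "('a \<Rightarrow> 'b) \<Rightarrow> ('a \<times> 'b) set" where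
  "lin_graph f = {(v, f v) | v. True}"


section \<open>Chevalley--Eilenberg cohomology and derivations\<close>

text \<open>
  Below, \<open>L\<close> is the vector space underlying a Lie algebra with bracket \<open>b\<close>, and \<open>\<rho>\<close> a
  representation on \<open>E\<close>. A \<open>k\<close>-cochain is an alternating multilinear map on lists of length \<open>k\<close> of
  elements of \<open>L\<close>.
\<close>

definition tuples :: "('k, 'l) module \<Rightarrow> nat \<Rightarrow> 'l list set" where
  "tuples L k = {xs. length xs = k \<and> set xs \<subseteq> carrier L}"

definition CE_cochains ::
    "('k, 'l) module \<Rightarrow> ('k, 'e) module \<Rightarrow> nat \<Rightarrow> ('l list \<Rightarrow> 'e) set" where
  "CE_cochains L E k =
     {c \<in> tuples L k \<rightarrow>\<^sub>E carrier E.
        (\<forall>xs\<in>tuples L k. \<forall>i<k. (\<lambda>x\<in>carrier L. c (xs[i := x])) \<in> lin_maps L E) \<and>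
        (\<forall>xs\<in>tuples L k. \<forall>i j. i < j \<and> j < k \<and> xs ! i = xs ! j \<longrightarrow> c xs = \<zero>\<^bsub>E\<^esub>)}"

text \<open>\<open>nths xs (- I)\<close> is \<open>xs\<close> with the entries at the (zero-based) positions in \<open>I\<close> omitted.\<close>

definition CE_diff ::
    "('k::field, 'l) module \<Rightarrow> ('l \<Rightarrow> 'l \<Rightarrow> 'l) \<Rightarrow> ('k, 'e) module \<Rightarrow> ('l \<Rightarrow> 'e \<Rightarrow> 'e) \<Rightarrow>
     nat \<Rightarrow> ('l list \<Rightarrow> 'e) \<Rightarrow> ('l list \<Rightarrow> 'e)" where
  "CE_diff L b E \<rho> k c =
     (\<lambda>xs\<in>tuples L (Suc k).
        (\<Oplus>\<^bsub>E\<^esub>i\<in>{..k}. (-1) ^ i \<odot>\<^bsub>E\<^esub> \<rho> (xs ! i) (c (nths xs (- {i})))) \<oplus>\<^bsub>E\<^esub>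
        (\<Oplus>\<^bsub>E\<^esub>p\<in>{(i, j). i < j \<and> j \<le> k}.
           (-1) ^ (fst p + snd p) \<odot>\<^bsub>E\<^esub>
             c (b (xs ! fst p) (xs ! snd p) # nths xs (- {fst p, snd p}))))"

definition CE_cocycles ::
    "('k::field, 'l) module \<Rightarrow> ('l \<Rightarrow> 'l \<Rightarrow> 'l) \<Rightarrow> ('k, 'e) module \<Rightarrow> ('l \<Rightarrow> 'e \<Rightarrow> 'e) \<Rightarrow>
     nat \<Rightarrow> ('l list \<Rightarrow> 'e) set" where
  "CE_cocycles L b E \<rho> k =
     {c \<in> CE_cochains L E k. CE_diff L b E \<rho> k c = (\<lambda>xs\<in>tuples L (Suc k). \<zero>\<^bsub>E\<^esub>)}"

definition CE_coboundaries ::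
    "('k::field, 'l) module \<Rightarrow> ('l \<Rightarrow> 'l \<Rightarrow> 'l) \<Rightarrow> ('k, 'e) module \<Rightarrow> ('l \<Rightarrow> 'e \<Rightarrow> 'e) \<Rightarrow>
     nat \<Rightarrow> ('l list \<Rightarrow> 'e) set" where
  "CE_coboundaries L b E \<rho> k =
     (case k of 0 \<Rightarrow> {\<lambda>xs\<in>tuples L 0. \<zero>\<^bsub>E\<^esub>}
              | Suc m \<Rightarrow> CE_diff L b E \<rho> m ` CE_cochains L E m)"

definition CE_cohomology ::
    "('k::field, 'l) module \<Rightarrow> ('l \<Rightarrow> 'l \<Rightarrow> 'l) \<Rightarrow> ('k, 'e) module \<Rightarrow> ('l \<Rightarrow> 'e \<Rightarrow> 'e) \<Rightarrow>
     nat \<Rightarrow> ('k, ('l list \<Rightarrow> 'e) set) module" where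
  "CE_cohomology L b E \<rho> k =
     quotient_space (fun_space (tuples L k) E (CE_cocycles L b E \<rho> k)) (CE_coboundaries L b E \<rho> k)"

definition Der_space ::
    "('k, 'l) module \<Rightarrow> ('l \<Rightarrow> 'l \<Rightarrow> 'l) \<Rightarrow> ('k, 'e) module \<Rightarrow> ('l \<Rightarrow> 'e \<Rightarrow> 'e) \<Rightarrow>
     ('k, 'l \<Rightarrow> 'e) module" where
  "Der_space L b E \<rho> = fun_space (carrier L) E
     {\<delta> \<in> lin_maps L E.
        \<forall>x\<in>carrier L. \<forall>y\<in>carrier L. \<delta> (b x y) = \<rho> x (\<delta> y) \<ominus>\<^bsub>E\<^esub> \<rho> y (\<delta> x)}"

text \<open>
  The representation of a Lie subalgebra \<open>S\<close> on the quotient by \<open>S\<close>: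
  \<open>\<rho> x (y + S) = m x y + S\<close> for \<open>x \<in> S\<close>.
\<close>

definition quotient_rep ::
    "('k, 'a) module \<Rightarrow> ('a \<Rightarrow> 'a \<Rightarrow> 'a) \<Rightarrow> 'a set \<Rightarrow> 'a \<Rightarrow> 'a set \<Rightarrow> 'a set" where
  "quotient_rep V m S x A = (\<Union>a\<in>A. S +>\<^bsub>V\<^esub> m x a)"

end

theory Submission
  imports Defs "HOL-Library.Function_Algebras"
begin

text \<open>
  Split \<open>V \<oplus> W\<close> along the graph of \<open>f\<close>: the map \<open>x \<mapsto> (x, f x)\<close> identifies \<open>V\<close> with the graph, and
  \<open>(v, w) \<mapsto> w - f v\<close> identifies the quotient by the graph with \<open>W\<close>. The Chevalley--Eilenberg
  complex of the theorem becomes a complex of alternating maps from \<open>V\<close> to \<open>W\<close>; in degrees 1 and 2 its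
  differentials, up to sign, are called \<open>d1\<close> and \<open>d2\<close> below, and the vanishing of \<open>H\<^sup>2\<close> says \<open>ker d2 = im d1\<close>.

  For a bracket \<open>M\<close> on \<open>V \<oplus> W\<close> and a linear map \<open>g\<close>, the alternating map
  \<open>\<Phi>(g) (x, y) = snd q - g (fst q)\<close> with \<open>q = M (x, g x) (y, g y)\<close> (\<open>graph_curvature\<close>) vanishes exactly
  when the graph of \<open>g\<close> is a subalgebra. For \<open>M\<close> near \<open>\<mu> \<oplus> \<nu>\<close> a zero \<open>g = f + h\<close> with small \<open>h\<close> is wanted.
  One has \<open>\<Phi>(f + h) = d1 h + (terms that are quadratic in h, or small with M - \<mu> \<oplus> \<nu>)\<close>, but \<open>d1\<close> only
  reaches \<open>ker d2\<close>, so the equation cannot be solved directly. It is solved in two steps, with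
  linear right inverses \<open>k\<close> of \<open>d1\<close> and \<open>K\<close> of \<open>d2\<close>; by exactness \<open>P = id - K d2\<close> is a projection onto
  \<open>im d1\<close>.

  \<^item> The map \<open>h \<mapsto> k (P (d1 h - \<Phi>(f + h)))\<close> is a contraction of a small ball. Applying \<open>d1\<close> to its fixed
    point \<open>h\<close> gives \<open>P (\<Phi>(f + h)) = 0\<close>, that is \<open>\<Phi> = K (d2 \<Phi>)\<close>.
  \<^item> The Jacobi identity of \<open>M\<close> is a Bianchi identity \<open>D \<Phi> = 0\<close> for a differential \<open>D\<close> that depends
    continuously on \<open>M\<close> and \<open>h\<close> and is \<open>d2\<close> at \<open>M = \<mu> \<oplus> \<nu>\<close>, \<open>h = 0\<close> (\<open>graph_curvature_Bianchi\<close>). Hence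
    \<open>\<Phi> = K ((d2 - D) \<Phi>)\<close> has at most half the norm of \<open>\<Phi>\<close>, and \<open>\<Phi> = 0\<close>.

  This is \<open>deformation_exists\<close>; the passage between the cohomology of the graph and \<open>d1\<close>, \<open>d2\<close> is
  \<open>exact_of_H2_zero\<close>, and \<open>nearby_subalgebras\<close> translates the norm estimates into open sets. The
  conclusion asks for a map from a neighbourhood of \<open>0\<close> in the space of derivations into \<open>N\<close>, all of whose
  values have a subalgebra as graph; a single such value \<open>g\<close> gives the constant map on the whole space.

  The dimensions of \<open>V\<close> and \<open>W\<close> are not part of their types, so the spaces of multilinear maps are
  subspaces of function types. Each carries finitely many explicit coordinates (locale \<open>coordinates\<close>)
  and the norm that sums the absolute values of the coordinates. The splittings \<open>k\<close> and \<open>K\<close> are found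
  by linear algebra on the full function types and are bounded on the multilinear maps because those
  have finitely many coordinates.
\<close>

section \<open>Seminorms and finite coordinate systems\<close>

definition seminorm :: "('k::real_normed_field \<Rightarrow> 'x::ab_group_add \<Rightarrow> 'x) \<Rightarrow> ('x \<Rightarrow> real) \<Rightarrow> bool" where
  "seminorm s p \<longleftrightarrow> vector_space s \<and>
     (\<forall>x y. p (x + y) \<le> p x + p y) \<and> (\<forall>c x. p (s c x) = norm c * p x)"

context
  fixes s :: "'k::real_normed_field \<Rightarrow> 'x::ab_group_add \<Rightarrow> 'x" and p :: "'x \<Rightarrow> real"
  assumes p: "seminorm s p"
begin

interpretation vector_space s using p by (simp add: seminorm_def)

lemma seminorm_triangle: "p (x + y) \<le> p x + p y"
  and seminorm_scale: "p (s c x) = norm c * p x"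
  using p by (auto simp: seminorm_def)

lemma seminorm_zero: "p 0 = 0"
  using seminorm_scale[of 0 0] by simp

lemma seminorm_minus: "p (- x) = p x"
  using seminorm_scale[of "-1" x] by simp

lemma seminorm_diff: "p (x - y) \<le> p x + p y"
  using seminorm_triangle[of x "- y"] by (simp add: seminorm_minus)

lemma seminorm_nonneg: "0 \<le> p x"
  using seminorm_diff[of x x] by (simp add: seminorm_zero)

lemma seminorm_sum: "p (sum h A) \<le> (\<Sum>a\<in>A. p (h a))"
proof (induction A rule: infinite_finite_induct)
  case (insert a A)
  then show ?case using seminorm_triangle[of "h a" "sum h A"] by simp
qed (auto simp: seminorm_zero)

end

text \<open>
  A basis \<open>e\<close> of the subspace \<open>S\<close> with its dual functionals \<open>\<alpha>\<close>. The functionals live on the whole type,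
  so that they are linear there and the coordinate norm is a seminorm on all vectors; only
  the expansion in the basis is confined to \<open>S\<close>.
\<close>

locale coordinates = vector_space s
  for s :: "'k::real_normed_field \<Rightarrow> 'x::ab_group_add \<Rightarrow> 'x" +
  fixes S :: "'x set" and J :: "'j set" and \<alpha> :: "'j \<Rightarrow> 'x \<Rightarrow> 'k" and e :: "'j \<Rightarrow> 'x"
  assumes finite_index: "finite J"
    and linear_coord: "\<And>j. j \<in> J \<Longrightarrow> Vector_Spaces.linear s (*) (\<alpha> j)"
    and subspace: "subspace S"
    and basis_in: "\<And>j. j \<in> J \<Longrightarrow> e j \<in> S"
    and dual: "\<And>i j. i \<in> J \<Longrightarrow> j \<in> J \<Longrightarrow> \<alpha> i (e j) = (if i = j then 1 else 0)"
    and expand: "\<And>x. x \<in> S \<Longrightarrow> (\<Sum>j\<in>J. s (\<alpha> j x) (e j)) = x"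

definition coord_norm :: "'j set \<Rightarrow> ('j \<Rightarrow> 'x \<Rightarrow> 'k::real_normed_field) \<Rightarrow> 'x \<Rightarrow> real" where
  "coord_norm J \<alpha> x = (\<Sum>j\<in>J. norm (\<alpha> j x))"

context coordinates
begin

lemma coord_add: "j \<in> J \<Longrightarrow> \<alpha> j (x + y) = \<alpha> j x + \<alpha> j y"
  and coord_scale: "j \<in> J \<Longrightarrow> \<alpha> j (s c x) = c * \<alpha> j x"
  using linear_coord[of j] by (auto simp: Vector_Spaces.linear_iff)

lemma coord_zero: "j \<in> J \<Longrightarrow> \<alpha> j 0 = 0"
  using coord_scale[of j 0 0] by simp

lemma coord_diff: "j \<in> J \<Longrightarrow> \<alpha> j (x - y) = \<alpha> j x - \<alpha> j y"
  using coord_add[of j "x - y" y] by simp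

lemma coord_sum: "j \<in> J \<Longrightarrow> \<alpha> j (sum h A) = (\<Sum>a\<in>A. \<alpha> j (h a))"
  by (induction A rule: infinite_finite_induct) (auto simp: coord_zero coord_add)

lemma combination_in: "(\<Sum>j\<in>J. s (c j) (e j)) \<in> S"
  by (intro subspace_sum[OF subspace] subspace_scale[OF subspace] basis_in)

lemma coord_combination: "i \<in> J \<Longrightarrow> \<alpha> i (\<Sum>j\<in>J. s (c j) (e j)) = c i"
  by (simp add: coord_sum coord_scale dual finite_index if_distrib cong: if_cong)

lemma seminorm_coord_norm: "seminorm s (coord_norm J \<alpha>)"
proof -
  have "coord_norm J \<alpha> (x + y) \<le> coord_norm J \<alpha> x + coord_norm J \<alpha> y" for x y
    unfolding coord_norm_def sum.distrib[symmetric]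
    by (rule sum_mono) (simp add: coord_add norm_triangle_ineq)
  moreover have "coord_norm J \<alpha> (s c x) = norm c * coord_norm J \<alpha> x" for c x
    by (simp add: coord_norm_def coord_scale norm_mult sum_distrib_left)
  ultimately show ?thesis
    using vector_space_axioms by (simp add: seminorm_def)
qed

lemma coord_norm_eq_0: "x \<in> S \<Longrightarrow> coord_norm J \<alpha> x = 0 \<Longrightarrow> x = 0"
  using expand[of x] by (simp add: coord_norm_def finite_index sum_nonneg_eq_0_iff)

lemma coord_norm_basis: "j \<in> J \<Longrightarrow> coord_norm J \<alpha> (e j) = 1"
  by (simp add: coord_norm_def dual finite_index if_distrib cong: if_cong)

text \<open>
  Expand in the basis: every linear map is bounded on \<open>S\<close>, whatever seminorm the target carries.
\<close>

lemma seminorm_linear_le: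
  assumes p: "seminorm s' p" and T: "Vector_Spaces.linear s s' T" and x: "x \<in> S"
  shows "p (T x) \<le> (\<Sum>j\<in>J. p (T (e j))) * coord_norm J \<alpha> x"
proof -
  interpret T: Vector_Spaces.linear s s' T by (rule T)
  have "T x = (\<Sum>j\<in>J. s' (\<alpha> j x) (T (e j)))"
    by (subst expand[OF x, symmetric]) (simp add: T.sum T.scale)
  then have "p (T x) \<le> (\<Sum>j\<in>J. p (s' (\<alpha> j x) (T (e j))))"
    using seminorm_sum[OF p] by metis
  also have "\<dots> \<le> (\<Sum>j\<in>J. p (T (e j)) * coord_norm J \<alpha> x)"
  proof (rule sum_mono)
    fix j assume "j \<in> J"
    then have "norm (\<alpha> j x) \<le> coord_norm J \<alpha> x"
      unfolding coord_norm_def by (intro member_le_sum) (auto simp: finite_index)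
    then show "p (s' (\<alpha> j x) (T (e j))) \<le> p (T (e j)) * coord_norm J \<alpha> x"
      by (simp add: seminorm_scale[OF p] seminorm_nonneg[OF p] mult.commute[of "p _"] mult_right_mono)
  qed
  finally show ?thesis by (simp add: sum_distrib_right)
qed

end

text \<open>
  Banach's argument for the iterates of \<open>0\<close>. Completeness is that of the scalar field: each
  coordinate of the iterates converges, and the limit vector is assembled from the basis.
\<close>

lemma coord_norm_contraction_fixpoint:
  fixes s :: "'k::{real_normed_field, banach} \<Rightarrow> 'x::ab_group_add \<Rightarrow> 'x"
    and \<alpha> :: "'j \<Rightarrow> 'x \<Rightarrow> 'k"
  assumes "coordinates s S J \<alpha> e"
  defines "p \<equiv> coord_norm J \<alpha>"
  assumes r: "0 \<le> r"
    and g_in: "\<And>x. x \<in> S \<Longrightarrow> p x \<le> r \<Longrightarrow> g x \<in> S \<and> p (g x) \<le> r"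
    and contr: "\<And>x y. x \<in> S \<Longrightarrow> y \<in> S \<Longrightarrow> p x \<le> r \<Longrightarrow> p y \<le> r \<Longrightarrow> p (g x - g y) \<le> p (x - y) / 2"
  shows "\<exists>x\<in>S. p x \<le> r \<and> g x = x"
proof -
  interpret coordinates s S J \<alpha> e by fact
  have p: "seminorm s p" unfolding p_def by (rule seminorm_coord_norm)
  define X where "X n = (g ^^ n) 0" for n
  have X0: "X 0 = 0" and XS: "X (Suc n) = g (X n)" for n by (simp_all add: X_def)
  have X: "X n \<in> S \<and> p (X n) \<le> r" for n
  proof (induction n)
    case 0 show ?case using r subspace_0[OF subspace] by (simp add: X0 seminorm_zero[OF p])
  qed (simp add: XS g_in)
  have step: "p (X (Suc n) - X n) \<le> r * (1/2) ^ n" for n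
  proof (induction n)
    case 0 show ?case using X[of 1] by (simp add: X0)
  next
    case (Suc n)
    have "p (X (Suc (Suc n)) - X (Suc n)) \<le> p (X (Suc n) - X n) / 2"
      unfolding XS[of "Suc n"] using contr[of "X (Suc n)" "X n"] X[of "Suc n"] X[of n]
      by (simp add: XS)
    then show ?case using Suc by simp
  qed
  have "\<exists>a. (\<lambda>n. \<alpha> j (X n)) \<longlonglongrightarrow> a" if j: "j \<in> J" for j
  proof -
    have "norm (\<alpha> j (X (Suc n)) - \<alpha> j (X n)) \<le> r * (1/2) ^ n" for n
    proof -
      have "norm (\<alpha> j (X (Suc n) - X n)) \<le> p (X (Suc n) - X n)"
        unfolding p_def coord_norm_def using j by (intro member_le_sum) (auto simp: finite_index)
      then show ?thesis using step[of n] by (simp add: coord_diff j)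
    qed
    moreover have "summable (\<lambda>n. r * (1/2::real) ^ n)" by (intro summable_mult summable_geometric) simp
    ultimately have "summable (\<lambda>n. \<alpha> j (X (Suc n)) - \<alpha> j (X n))"
      by (rule summable_comparison_test'[where N = 0, rotated])
    then have "convergent (\<lambda>n. \<Sum>i<n. \<alpha> j (X (Suc i)) - \<alpha> j (X i))"
      by (simp only: summable_iff_convergent)
    then have "convergent (\<lambda>n. \<alpha> j (X n) - \<alpha> j (X 0))"
      by (simp only: sum_lessThan_telescope[of "\<lambda>n. \<alpha> j (X n)"])
    then have "convergent (\<lambda>n. \<alpha> j (X n) - \<alpha> j (X 0) + \<alpha> j (X 0))"
      by (intro convergent_add convergent_const)
    then show ?thesis by (simp add: convergent_def)
  qed
  then obtain a where a: "\<And>j. j \<in> J \<Longrightarrow> (\<lambda>n. \<alpha> j (X n)) \<longlonglongrightarrow> a j" by metis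
  define x where "x = (\<Sum>j\<in>J. s (a j) (e j))"
  have xS: "x \<in> S" unfolding x_def by (rule combination_in)
  have \<alpha>x: "\<alpha> j x = a j" if "j \<in> J" for j using that by (simp add: x_def coord_combination)
  have "(\<lambda>n. \<Sum>j\<in>J. norm (\<alpha> j (X n) - a j)) \<longlonglongrightarrow> (\<Sum>j\<in>J. norm (a j - a j))"
    by (intro tendsto_intros a)
  moreover have "(\<Sum>j\<in>J. norm (\<alpha> j (X n) - a j)) = p (X n - x)" for n
    by (simp add: p_def coord_norm_def coord_diff \<alpha>x)
  ultimately have lim: "(\<lambda>n. p (X n - x)) \<longlonglongrightarrow> 0" by simp
  have px: "p x \<le> r"
  proof (rule LIMSEQ_le_const)
    show "(\<lambda>n. p (X n - x) + r) \<longlonglongrightarrow> r" using tendsto_add[OF lim tendsto_const[of r]] by simp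
    have "p x \<le> p (X n - x) + r" for n
      using seminorm_diff[OF p, of "X n" "X n - x"] X[of n] by simp
    then show "\<exists>N. \<forall>n\<ge>N. p x \<le> p (X n - x) + r" by blast
  qed
  have "p (g x - x) \<le> 0"
  proof (rule LIMSEQ_le_const)
    show "(\<lambda>n. p (X n - x) / 2 + p (X (Suc n) - x)) \<longlonglongrightarrow> 0"
      using tendsto_add[OF tendsto_divide[OF lim tendsto_const[of 2]] LIMSEQ_Suc[OF lim]] by simp
    have "p (g x - x) \<le> p (X n - x) / 2 + p (X (Suc n) - x)" for n
    proof -
      have "p (g x - x) = p ((X (Suc n) - x) - (g (X n) - g x))" by (simp add: XS)
      also have "\<dots> \<le> p (X (Suc n) - x) + p (g (X n) - g x)" by (rule seminorm_diff[OF p])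
      finally show ?thesis using contr[of "X n" x] X[of n] xS px by simp
    qed
    then show "\<exists>N. \<forall>n\<ge>N. p (g x - x) \<le> p (X n - x) / 2 + p (X (Suc n) - x)" by blast
  qed
  then have "p (g x - x) = 0" using seminorm_nonneg[OF p, of "g x - x"] by simp
  moreover have "g x - x \<in> S" using g_in xS px by (intro subspace_diff[OF subspace]) auto
  ultimately have "g x - x = 0" using coord_norm_eq_0 unfolding p_def by blast
  then show ?thesis using xS px by auto
qed

section \<open>Coordinates on spaces of multilinear maps\<close>

definition fun_scale :: "('k \<Rightarrow> 'y \<Rightarrow> 'y) \<Rightarrow> 'k \<Rightarrow> ('x \<Rightarrow> 'y) \<Rightarrow> 'x \<Rightarrow> 'y" where
  "fun_scale s c f = (\<lambda>x. s c (f x))"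

lemma vector_space_fun_scale: "vector_space s \<Longrightarrow> vector_space (fun_scale s)"
  by (simp add: vector_space_def fun_scale_def fun_eq_iff)

lemma sum_fun_apply: "(\<Sum>a\<in>A. h a) x = (\<Sum>a\<in>A. h a x :: 'y::comm_monoid_add)"
  by (induction A rule: infinite_finite_induct) auto

lemma coordinates_basis:
  assumes "finite_dimensional_vector_space s B"
  shows "coordinates s UNIV B (\<lambda>b x. module.representation s B x b) (\<lambda>b. b)"
proof -
  interpret finite_dimensional_vector_space s B by fact
  show ?thesis
  proof (intro coordinates.intro coordinates_axioms.intro vector_space_axioms)
    show "Vector_Spaces.linear s (*) (\<lambda>x. representation B x b)" for b
      by (rule linear_representation[OF independent_Basis span_Basis])
    show "(\<Sum>b\<in>B. s (representation B x b) b) = x" for x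
      using sum_representation_eq[OF independent_Basis, of x B] by (simp add: span_Basis finite_Basis)
    show "representation B j i = (if i = j then 1 else 0)" if "i \<in> B" "j \<in> B" for i j
      using representation_basis[OF independent_Basis that(2)] by auto
  qed (auto simp: finite_Basis)
qed

definition linear_maps_into ::
    "('k::field \<Rightarrow> 'x::ab_group_add \<Rightarrow> 'x) \<Rightarrow> ('k \<Rightarrow> 'y::ab_group_add \<Rightarrow> 'y) \<Rightarrow> 'y set \<Rightarrow> ('x \<Rightarrow> 'y) set" where
  "linear_maps_into sX sY S = {c. Vector_Spaces.linear sX sY c \<and> range c \<subseteq> S}"

text \<open>
  A linear map is determined by the coordinates of its values on a basis of the source. Iterating
  this gives coordinates on bilinear and trilinear maps in curried form.
\<close>

lemma coordinates_linear_maps: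
  assumes X: "coordinates sX UNIV I \<xi> b" and Y: "coordinates sY S J \<alpha> e"
  shows "coordinates (fun_scale sY) (linear_maps_into sX sY S) (I \<times> J)
           (\<lambda>(i, j) c. \<alpha> j (c (b i))) (\<lambda>(i, j) x. sY (\<xi> i x) (e j))"
proof -
  interpret X: coordinates sX UNIV I \<xi> b by fact
  interpret Y: coordinates sY S J \<alpha> e by fact
  interpret F: vector_space "fun_scale sY" by (rule vector_space_fun_scale) unfold_locales
  note lin = Vector_Spaces.linear_iff fun_scale_def
  show ?thesis
  proof (intro coordinates.intro coordinates_axioms.intro F.vector_space_axioms, goal_cases)
    case 1
    then show ?case by (simp add: X.finite_index Y.finite_index)
  next
    case (2 j)
    then show ?case using F.vector_space_axioms Y.linear_coord
      by (auto simp: lin)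
  next
    case 3
    show ?case
      using Y.subspace_0[OF Y.subspace] Y.subspace_add[OF Y.subspace] Y.subspace_scale[OF Y.subspace]
      by (intro F.subspaceI)
        (auto simp: linear_maps_into_def lin image_subset_iff algebra_simps X.vector_space_axioms
          Y.vector_space_axioms)
  next
    case (4 j)
    then show ?case
      by (auto simp: linear_maps_into_def lin image_subset_iff algebra_simps X.vector_space_axioms
          Y.vector_space_axioms X.coord_add X.coord_scale intro!: Y.subspace_scale[OF Y.subspace] Y.basis_in)
  next
    case (5 i j)
    then show ?case by (auto simp: X.dual Y.dual Y.coord_scale split: if_splits)
  next
    case (6 c)
    then have c: "Vector_Spaces.linear sX sY c" "\<And>x. c x \<in> S" by (auto simp: linear_maps_into_def)
    interpret c: Vector_Spaces.linear sX sY c by fact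
    show ?case
    proof
      fix x
      have "(\<Sum>i\<in>I. \<Sum>j\<in>J. sY (\<alpha> j (c (b i))) (sY (\<xi> i x) (e j)))
          = (\<Sum>i\<in>I. sY (\<xi> i x) (\<Sum>j\<in>J. sY (\<alpha> j (c (b i))) (e j)))"
        by (simp add: Y.scale_sum_right mult.commute)
      also have "\<dots> = c (\<Sum>i\<in>I. sX (\<xi> i x) (b i))"
        by (simp add: Y.expand c c.sum c.scale)
      also have "\<dots> = c x" by (simp add: X.expand)
      finally show "(\<Sum>j\<in>I \<times> J. fun_scale sY ((case j of (i, j) \<Rightarrow> \<lambda>c. \<alpha> j (c (b i))) c)
            (case j of (i, j) \<Rightarrow> \<lambda>x. sY (\<xi> i x) (e j))) x = c x"
        by (simp add: sum_fun_apply sum.cartesian_product fun_scale_def split_def)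
    qed
  qed
qed

lemma coord_norm_linear_maps:
  "coord_norm (I \<times> J) (\<lambda>(i, j) c. \<alpha> j (c (b i))) c = (\<Sum>i\<in>I. coord_norm J \<alpha> (c (b i)))"
  by (simp add: coord_norm_def sum.cartesian_product split_def)

section \<open>Linear and bilinear maps\<close>

lemma linear_map_simps:
  assumes "Vector_Spaces.linear s s' T"
  shows "T (x + y) = T x + T y" "T (x - y) = T x - T y" "T (- x) = - T x" "T 0 = 0"
    "T (s c x) = s' c (T x)"
proof -
  interpret Vector_Spaces.linear s s' T by fact
  show "T (x + y) = T x + T y" "T (x - y) = T x - T y" "T (- x) = - T x" "T 0 = 0"
    "T (s c x) = s' c (T x)"
    by (simp_all add: add diff neg scale)
qed

lemma linear_map_compose:
  "Vector_Spaces.linear s' s'' T \<Longrightarrow> Vector_Spaces.linear s s' A \<Longrightarrow> Vector_Spaces.linear s s'' (\<lambda>x. T (A x))"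
  by (simp add: Vector_Spaces.linear_iff)

lemma linear_map_add:
  "Vector_Spaces.linear s s' A \<Longrightarrow> Vector_Spaces.linear s s' B \<Longrightarrow> Vector_Spaces.linear s s' (\<lambda>x. A x + B x)"
  by (simp add: Vector_Spaces.linear_iff vector_space_def algebra_simps)

lemma linear_map_minus:
  assumes "Vector_Spaces.linear s s' A"
  shows "Vector_Spaces.linear s s' (\<lambda>x. - A x)"
proof -
  interpret Vector_Spaces.linear s s' A by fact
  show ?thesis
    using vs1.vector_space_axioms vs2.vector_space_axioms
    by (simp add: Vector_Spaces.linear_iff add scale)
qed

lemma linear_map_diff:
  "Vector_Spaces.linear s s' A \<Longrightarrow> Vector_Spaces.linear s s' B \<Longrightarrow> Vector_Spaces.linear s s' (\<lambda>x. A x - B x)"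
  using linear_map_add[OF _ linear_map_minus, of s s' A B] by simp

lemma linear_map_scale:
  assumes "Vector_Spaces.linear s s' A"
  shows "Vector_Spaces.linear s s' (\<lambda>x. s' c (A x))"
proof -
  interpret Vector_Spaces.linear s s' A by fact
  show ?thesis
    using vs1.vector_space_axioms vs2.vector_space_axioms
    by (simp add: Vector_Spaces.linear_iff add scale vs2.scale_right_distrib vs2.scale_left_commute)
qed

lemma linear_map_id: "vector_space s \<Longrightarrow> Vector_Spaces.linear s s (\<lambda>x. x)"
  by (simp add: Vector_Spaces.linear_iff)

lemma linear_map_zero:
  assumes "vector_space s" "vector_space s'"
  shows "Vector_Spaces.linear s s' (\<lambda>x. 0)"
proof -
  interpret vector_space s' by fact
  show ?thesis using assms by (simp add: Vector_Spaces.linear_iff)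
qed

lemma linear_map_into_fun_iff:
  assumes "vector_space s'"
  shows "Vector_Spaces.linear s (fun_scale s') c \<longleftrightarrow> (\<forall>y. Vector_Spaces.linear s s' (\<lambda>x. c x y))"
  using assms vector_space_fun_scale[OF assms]
  by (auto simp: Vector_Spaces.linear_iff fun_scale_def fun_eq_iff)

abbreviation prod_scale :: "('k \<Rightarrow> 'v \<Rightarrow> 'v) \<Rightarrow> ('k \<Rightarrow> 'w \<Rightarrow> 'w) \<Rightarrow> 'k \<Rightarrow> 'v \<times> 'w \<Rightarrow> 'v \<times> 'w" where
  "prod_scale s s' \<equiv> (\<lambda>c p. (s c (fst p), s' c (snd p)))"

lemma module_prod_scale_eq:
  assumes "vector_space s" "vector_space s'"
  shows "module_prod.scale s s' = prod_scale s s'"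
proof -
  interpret vector_space_prod s s'
    using assms by (simp add: vector_space_prod_def vector_space_pair_def)
  show ?thesis by (simp add: fun_eq_iff scale_def split_def)
qed

lemma vector_space_prod_scale:
  "vector_space s \<Longrightarrow> vector_space s' \<Longrightarrow> vector_space (prod_scale s s')"
  by (simp add: vector_space_def)

lemma linear_map_pair:
  "Vector_Spaces.linear s s' A \<Longrightarrow> Vector_Spaces.linear s s'' B \<Longrightarrow>
   Vector_Spaces.linear s (prod_scale s' s'') (\<lambda>x. (A x, B x))"
  using vector_space_prod_scale[of s' s''] by (simp add: Vector_Spaces.linear_iff)

lemma linear_map_fst: "vector_space s \<Longrightarrow> vector_space s' \<Longrightarrow> Vector_Spaces.linear (prod_scale s s') s fst"
  and linear_map_snd: "vector_space s \<Longrightarrow> vector_space s' \<Longrightarrow> Vector_Spaces.linear (prod_scale s s') s' snd"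
  using vector_space_prod_scale[of s s'] by (simp_all add: Vector_Spaces.linear_iff)

lemma alt_bilinear_simps:
  assumes "m \<in> alt_bilinear s"
  shows "m (x + y) z = m x z + m y z" "m (x - y) z = m x z - m y z" "m (- x) z = - m x z" "m 0 z = 0"
    "m z (x + y) = m z x + m z y" "m z (x - y) = m z x - m z y" "m z (- x) = - m z x" "m z 0 = 0"
    "m (s c x) z = s c (m x z)" "m z (s c x) = s c (m z x)" "m x x = 0"
proof -
  have *: "Vector_Spaces.linear s s (m z)" "Vector_Spaces.linear s s (\<lambda>x. m x z)" for z
    using assms by (auto simp: alt_bilinear_def)
  show "m (x + y) z = m x z + m y z" "m (x - y) z = m x z - m y z" "m (- x) z = - m x z" "m 0 z = 0"
    "m z (x + y) = m z x + m z y" "m z (x - y) = m z x - m z y" "m z (- x) = - m z x" "m z 0 = 0"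
    "m (s c x) z = s c (m x z)" "m z (s c x) = s c (m z x)" "m x x = 0"
    using linear_map_simps[OF *(1)[of z]] linear_map_simps[OF *(2)[of z]] assms
    by (auto simp: alt_bilinear_def)
qed

lemma alt_bilinear_diff:
  assumes "M \<in> alt_bilinear s" "M' \<in> alt_bilinear s"
  shows "M - M' \<in> alt_bilinear s"
  using assms linear_map_diff[of s s] by (simp add: alt_bilinear_def fun_diff_def del: split_paired_All)

lemma alternating_skew:
  assumes "\<And>x y z. m (x + y) z = m x z + m y z" "\<And>x y z. m z (x + y) = m z x + m z y" "\<And>x. m x x = (0::'a::ab_group_add)"
  shows "m y x = - m x y"
proof -
  have "m (x + y) (x + y) = m x y + m y x" unfolding assms(1,2) by (simp add: assms(3))
  then show ?thesis using assms(3)[of "x + y"] by (metis add_eq_0_iff)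
qed

lemma sum_Pair: "(\<Sum>a\<in>A. (F a, G a)) = (sum F A, sum G A)"
  by (induction A rule: infinite_finite_induct) (auto simp: zero_prod_def)

text \<open>
  The coordinates of \<open>V \<oplus> W\<close> are indexed by a disjoint sum, which makes the norm of a pair the sum of
  the norms of its components.
\<close>

lemma coordinates_prod:
  assumes V: "coordinates sV UNIV I \<xi> b" and W: "coordinates sW UNIV J \<eta> e"
  shows "coordinates (prod_scale sV sW) UNIV (I <+> J)
    (\<lambda>k p. case k of Inl i \<Rightarrow> \<xi> i (fst p) | Inr j \<Rightarrow> \<eta> j (snd p))
    (\<lambda>k. case k of Inl i \<Rightarrow> (b i, 0) | Inr j \<Rightarrow> (0, e j))"
proof -
  interpret V: coordinates sV UNIV I \<xi> b by fact
  interpret W: coordinates sW UNIV J \<eta> e by fact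
  interpret P: vector_space "prod_scale sV sW"
    by (rule vector_space_prod_scale[OF V.vector_space_axioms W.vector_space_axioms])
  show ?thesis
  proof (intro coordinates.intro coordinates_axioms.intro P.vector_space_axioms, goal_cases)
    case (2 k)
    then show ?case
      using linear_map_compose[OF V.linear_coord linear_map_fst[OF V.vector_space_axioms W.vector_space_axioms]]
        linear_map_compose[OF W.linear_coord linear_map_snd[OF V.vector_space_axioms W.vector_space_axioms]]
      by auto
  next
    case (6 p)
    show ?case
      by (simp add: sum.Plus V.finite_index W.finite_index sum_Pair V.expand W.expand)
  qed (auto simp: V.finite_index W.finite_index V.dual W.dual V.coord_zero W.coord_zero split: if_splits)
qed

lemma coord_norm_prod:
  assumes "finite I" "finite J"
  shows "coord_norm (I <+> J) (\<lambda>k p. case k of Inl i \<Rightarrow> \<xi> i (fst p) | Inr j \<Rightarrow> \<eta> j (snd p)) p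
    = coord_norm I \<xi> (fst p) + coord_norm J \<eta> (snd p)"
  using assms by (simp add: coord_norm_def sum.Plus)

text \<open>
  The coordinate norm on linear maps written without coordinates of the target. In this form it
  can be iterated over curried arguments and plays the role of an operator norm: the next lemmas bound
  a map pointwise by it, and it by any pointwise bound.
\<close>

definition lin_norm :: "'i set \<Rightarrow> ('i \<Rightarrow> 'x) \<Rightarrow> ('y \<Rightarrow> real) \<Rightarrow> ('x \<Rightarrow> 'y) \<Rightarrow> real" where
  "lin_norm I b p c = (\<Sum>i\<in>I. p (c (b i)))"

lemma seminorm_lin_norm:
  assumes p: "seminorm s p"
  shows "seminorm (fun_scale s) (lin_norm I b p)"
proof -
  have "vector_space s" using p by (simp add: seminorm_def)
  note vector_space_fun_scale[OF this]
  then show ?thesis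
    unfolding seminorm_def lin_norm_def sum.distrib[symmetric]
    by (auto simp: fun_scale_def seminorm_scale[OF p] sum_distrib_left intro!: sum_mono seminorm_triangle[OF p])
qed

context coordinates
begin

lemma apply_le_lin_norm:
  assumes "seminorm s' p" "Vector_Spaces.linear s s' T" "S = UNIV"
  shows "p (T x) \<le> lin_norm J e p T * coord_norm J \<alpha> x"
  using seminorm_linear_le[OF assms(1,2), of x] assms(3) by (simp add: lin_norm_def)

lemma lin_norm_le:
  assumes "\<And>x. p (T x) \<le> K * coord_norm J \<alpha> x"
  shows "lin_norm J e p T \<le> real (card J) * K"
  unfolding lin_norm_def
proof (rule sum_bounded_above)
  show "p (T (e j)) \<le> K" if "j \<in> J" for j
    using assms[of "e j"] that by (simp add: coord_norm_basis)
qed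

end

lemma bilinear_le_lin_norm:
  assumes X: "coordinates s UNIV I \<xi> b" and p: "seminorm s' p"
    and c: "\<And>x. Vector_Spaces.linear s s' (c x)" "\<And>y. Vector_Spaces.linear s s' (\<lambda>x. c x y)"
  shows "p (c x y) \<le> lin_norm I b (lin_norm I b p) c * coord_norm I \<xi> x * coord_norm I \<xi> y"
proof -
  interpret X: coordinates s UNIV I \<xi> b by fact
  have s': "vector_space s'" using p by (simp add: seminorm_def)
  have "p (c x y) \<le> lin_norm I b p (c x) * coord_norm I \<xi> y"
    by (rule X.apply_le_lin_norm[OF p c(1) refl])
  also have "lin_norm I b p (c x) \<le> lin_norm I b (lin_norm I b p) c * coord_norm I \<xi> x"
    by (rule X.apply_le_lin_norm[OF seminorm_lin_norm[OF p] _ refl])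
      (simp add: linear_map_into_fun_iff[OF s'] c)
  finally show ?thesis
    using seminorm_nonneg[OF X.seminorm_coord_norm, of y] by (simp add: mult_right_mono)
qed

lemma coordinates_linear_maps_lin_norm:
  assumes X: "coordinates sX UNIV I \<xi> b" and Y: "coordinates sY S J \<alpha> e"
  shows "\<exists>\<alpha>' e'. coordinates (fun_scale sY) (linear_maps_into sX sY S) (I \<times> J) \<alpha>' e' \<and>
    coord_norm (I \<times> J) \<alpha>' = lin_norm I b (coord_norm J \<alpha>)"
  using coordinates_linear_maps[OF X Y]
  by (intro exI[where x = "\<lambda>(i, j) c. \<alpha> j (c (b i))"] exI[where x = "\<lambda>(i, j) x. sY (\<xi> i x) (e j)"])
    (auto simp: fun_eq_iff coord_norm_linear_maps lin_norm_def)

section \<open>Neighbourhoods in the initial topology\<close>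

text \<open>
  Closure under the operations makes the zero functional, restricted to the carrier, linear; the whole
  carrier is its preimage of the scalar field.
\<close>

lemma openin_vs_topology_carrier:
  assumes "\<And>x y. x \<in> carrier X \<Longrightarrow> y \<in> carrier X \<Longrightarrow> x \<oplus>\<^bsub>X\<^esub> y \<in> carrier X"
    and "\<And>c x. x \<in> carrier X \<Longrightarrow> c \<odot>\<^bsub>X\<^esub> x \<in> carrier X"
  shows "openin (vs_topology X) (carrier X)"
proof -
  have "(\<lambda>x\<in>carrier X. 0) \<in> lin_maps X (vspace_on (*) UNIV)"
    using assms by (auto simp: lin_maps_def vspace_on_def)
  then have "\<exists>\<phi> U. carrier X = {x \<in> carrier X. \<phi> x \<in> U} \<and> \<phi> \<in> lin_maps X (vspace_on (*) UNIV) \<and> open U"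
    by (intro exI[of _ "\<lambda>x\<in>carrier X. 0"] exI[of _ UNIV]) simp
  then show ?thesis
    unfolding vs_topology_def by (intro topology_generated_by_Basis) blast
qed

lemma openin_vs_topology_ball:
  assumes "\<phi> \<in> lin_maps X (vspace_on (*) UNIV)"
  shows "openin (vs_topology X) {x \<in> carrier X. norm (\<phi> x - a) < \<delta>}"
proof -
  have "{x \<in> carrier X. norm (\<phi> x - a) < \<delta>} = {x \<in> carrier X. \<phi> x \<in> ball a \<delta>}"
    by (auto simp: dist_norm norm_minus_commute)
  then show ?thesis
    unfolding vs_topology_def using assms open_ball by (intro topology_generated_by_Basis) blast
qed

lemma (in coordinates) functional_le_coord_norm:
  assumes add: "\<And>x y. x \<in> S \<Longrightarrow> y \<in> S \<Longrightarrow> \<phi> (x + y) = \<phi> x + \<phi> y"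
    and scale: "\<And>c x. x \<in> S \<Longrightarrow> \<phi> (s c x) = c * \<phi> x"
    and x: "x \<in> S"
  shows "norm (\<phi> x) \<le> (\<Sum>j\<in>J. norm (\<phi> (e j))) * coord_norm J \<alpha> x"
proof -
  have zero: "\<phi> 0 = 0" using scale[of x 0] x by simp
  have "\<phi> (\<Sum>j\<in>A. s (\<alpha> j x) (e j)) = (\<Sum>j\<in>A. \<alpha> j x * \<phi> (e j))" if "A \<subseteq> J" for A
    using finite_subset[OF that finite_index] that
  proof (induction A rule: finite_induct)
    case (insert j A)
    then have "(\<Sum>j\<in>A. s (\<alpha> j x) (e j)) \<in> S" "s (\<alpha> j x) (e j) \<in> S"
      by (auto intro!: subspace_sum[OF subspace] subspace_scale[OF subspace] basis_in)
    then show ?case using insert by (simp add: add scale basis_in)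
  qed (simp add: zero)
  from this[OF order_refl] have "\<phi> x = (\<Sum>j\<in>J. \<alpha> j x * \<phi> (e j))" by (simp add: expand[OF x])
  then have "norm (\<phi> x) \<le> (\<Sum>j\<in>J. norm (\<phi> (e j)) * norm (\<alpha> j x))"
    using norm_sum[of "\<lambda>j. \<alpha> j x * \<phi> (e j)" J] by (simp add: norm_mult mult.commute)
  also have "\<dots> \<le> (\<Sum>j\<in>J. norm (\<phi> (e j)) * coord_norm J \<alpha> x)"
    unfolding coord_norm_def
    by (intro sum_mono mult_left_mono member_le_sum) (auto simp: finite_index)
  finally show ?thesis by (simp add: sum_distrib_right)
qed

text \<open>
  A linear functional is Lipschitz for the coordinate norm, so coordinate balls fit into each of
  the generating open sets; finite intersections and unions preserve this.
\<close>

lemma vs_topology_contains_coord_ball: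
  fixes s :: "'k::{real_normed_field, euclidean_space} \<Rightarrow> 'x::ab_group_add \<Rightarrow> 'x"
  assumes "coordinates s S J \<alpha> e"
    and X: "carrier X = S" "\<And>x y. x \<oplus>\<^bsub>X\<^esub> y = x + y" "\<And>c x. c \<odot>\<^bsub>X\<^esub> x = s c x"
    and N: "openin (vs_topology X) N" "x \<in> N"
  shows "x \<in> S \<and> (\<exists>\<epsilon>>0. \<forall>h\<in>S. coord_norm J \<alpha> h < \<epsilon> \<longrightarrow> x + h \<in> N)"
proof -
  interpret coordinates s S J \<alpha> e by fact
  have "generate_topology_on {{x \<in> carrier X. \<phi> x \<in> U} |\<phi> U. \<phi> \<in> lin_maps X (vspace_on (*) UNIV) \<and> open U} N"
    using N(1) unfolding vs_topology_def by (rule openin_topology_generated_by)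
  then show ?thesis using N(2)
  proof (induction arbitrary: x rule: generate_topology_on.induct)
    case (Int a b)
    have "x \<in> a" "x \<in> b" using Int.prems by auto
    with Int.IH(1)[of x] Int.IH(2)[of x] obtain \<epsilon>1 \<epsilon>2 where "\<epsilon>1 > 0" "\<epsilon>2 > 0"
      "\<forall>h\<in>S. coord_norm J \<alpha> h < \<epsilon>1 \<longrightarrow> x + h \<in> a" "\<forall>h\<in>S. coord_norm J \<alpha> h < \<epsilon>2 \<longrightarrow> x + h \<in> b" "x \<in> S"
      by blast
    then show ?case by (intro conjI exI[of _ "min \<epsilon>1 \<epsilon>2"]) auto
  next
    case (UN K)
    then obtain k where "k \<in> K" "x \<in> k" by blast
    then show ?case using UN.IH[of k x] by blast
  next
    case (Basis B)
    then obtain \<phi> U where B: "B = {x \<in> S. \<phi> x \<in> U}" and \<phi>: "\<phi> \<in> lin_maps X (vspace_on (*) UNIV)" and U: "open U"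
      by (auto simp: X)
    have add: "\<phi> (x + y) = \<phi> x + \<phi> y" if "x \<in> S" "y \<in> S" for x y
      using \<phi> that by (simp add: lin_maps_def X) (simp add: vspace_on_def)
    have scale: "\<phi> (s c x) = c * \<phi> x" if "x \<in> S" for c x
      using \<phi> that by (simp add: lin_maps_def X) (simp add: vspace_on_def)
    have x: "x \<in> S" "\<phi> x \<in> U" using Basis B by auto
    obtain d where d: "d > 0" "ball (\<phi> x) d \<subseteq> U" using U x(2) by (auto simp: open_contains_ball)
    define C where "C = (\<Sum>j\<in>J. norm (\<phi> (e j)))"
    have C: "0 \<le> C" by (simp add: C_def sum_nonneg)
    have "x + h \<in> B" if h: "h \<in> S" "coord_norm J \<alpha> h < d / (C + 1)" for h
    proof -
      have "norm (\<phi> h) \<le> C * coord_norm J \<alpha> h"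
        unfolding C_def by (rule functional_le_coord_norm[OF add scale h(1)])
      also have "\<dots> \<le> (C + 1) * coord_norm J \<alpha> h"
        using seminorm_nonneg[OF seminorm_coord_norm, of h] by (simp add: algebra_simps)
      also have "\<dots> < d" using h(2) C by (simp add: pos_less_divide_eq mult.commute)
      finally have "\<phi> (x + h) \<in> ball (\<phi> x) d" by (simp add: add x h dist_norm)
      then show ?thesis using d(2) x(1) h(1) subspace_add[OF subspace] by (auto simp: B)
    qed
    moreover have "d / (C + 1) > 0" using d(1) C by simp
    ultimately show ?case using x(1) by blast
  qed simp
qed

text \<open>
  The coordinates of the structure constants are linear functionals of the bracket, and there are
  finitely many of them.
\<close>

lemma openin_lie_topology_coord_ball:
  fixes s :: "'k::{real_normed_field, euclidean_space} \<Rightarrow> 'x::ab_group_add \<Rightarrow> 'x"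
  assumes X: "coordinates s UNIV I \<xi> b"
  shows "openin (lie_topology s)
    {M \<in> lie_structures s. \<forall>i\<in>I. \<forall>j\<in>I. \<forall>k\<in>I. norm (\<xi> k (M (b i) (b j)) - \<xi> k (M0 (b i) (b j))) < \<delta>}"
proof -
  interpret coordinates s UNIV I \<xi> b by fact
  let ?X = "alt_bilinear_space s"
  have car: "carrier ?X = alt_bilinear s"
    and add: "M \<oplus>\<^bsub>?X\<^esub> M' = (\<lambda>x y. M x y + M' x y)"
    and scale: "c \<odot>\<^bsub>?X\<^esub> M = (\<lambda>x y. s c (M x y))" for M M' c
    by (simp_all add: alt_bilinear_space_def fun_space_def vspace_on_def fun_eq_iff)
  have closed: "M \<oplus>\<^bsub>?X\<^esub> M' \<in> carrier ?X" "c \<odot>\<^bsub>?X\<^esub> M \<in> carrier ?X"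
    if "M \<in> carrier ?X" "M' \<in> carrier ?X" for M M' c
    using that unfolding car add scale
    by (auto simp: alt_bilinear_def intro!: linear_map_add linear_map_scale)
  define \<phi> where "\<phi> = (\<lambda>(i, j, k). \<lambda>M\<in>carrier ?X. \<xi> k (M (b i) (b j)))"
  define a where "a = (\<lambda>(i, j, k). \<xi> k (M0 (b i) (b j)))"
  have \<phi>: "\<phi> t \<in> lin_maps ?X (vspace_on (*) UNIV)" if "t \<in> I \<times> I \<times> I" for t
    using that closed by (auto simp: \<phi>_def lin_maps_def) (auto simp: vspace_on_def add scale coord_add coord_scale)
  define T where "T = (\<Inter>t\<in>I \<times> I \<times> I. {M \<in> carrier ?X. norm (\<phi> t M - a t) < \<delta>}) \<inter> carrier ?X"
  have "openin (vs_topology ?X) (carrier ?X)"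
    by (rule openin_vs_topology_carrier) (rule closed, assumption+)+
  moreover from this have "carrier ?X \<subseteq> topspace (vs_topology ?X)" by (rule openin_subset)
  moreover have "openin (vs_topology ?X)
      ((\<Inter>t\<in>I \<times> I \<times> I. {M \<in> carrier ?X. norm (\<phi> t M - a t) < \<delta>}) \<inter> topspace (vs_topology ?X))"
    by (intro openin_INT openin_vs_topology_ball \<phi>) (simp add: finite_index)
  ultimately have "openin (vs_topology ?X) T"
    unfolding T_def by (metis (no_types, lifting) inf.absorb2 inf.assoc openin_Int)
  moreover have "{M \<in> lie_structures s. \<forall>i\<in>I. \<forall>j\<in>I. \<forall>k\<in>I. norm (\<xi> k (M (b i) (b j)) - \<xi> k (M0 (b i) (b j))) < \<delta>}
    = T \<inter> lie_structures s"
    by (auto simp: T_def \<phi>_def a_def car lie_structures_def)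
  ultimately show ?thesis
    unfolding lie_topology_def openin_subtopology by blast
qed

section \<open>Curvature of a graph\<close>

definition graph_defect :: "('v \<Rightarrow> 'w) \<Rightarrow> 'v \<times> 'w::ab_group_add \<Rightarrow> 'w" where
  "graph_defect g q = snd q - g (fst q)"

text \<open>
  Transported to \<open>V\<close> by \<open>x \<mapsto> (x, g x)\<close> and to \<open>W\<close> by \<open>graph_defect g\<close>, these are the bracket of the graph
  and its action on the quotient. They are defined for every \<open>M\<close> and \<open>g\<close>; when the graph is not
  a subalgebra they need not form a Lie algebra with a representation.
\<close>

definition graph_bracket :: "('v \<times> 'w \<Rightarrow> 'v \<times> 'w \<Rightarrow> 'v \<times> 'w) \<Rightarrow> ('v \<Rightarrow> 'w) \<Rightarrow> 'v \<Rightarrow> 'v \<Rightarrow> 'v" where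
  "graph_bracket M g x y = fst (M (x, g x) (y, g y))"

definition graph_action ::
    "('v::zero \<times> 'w \<Rightarrow> 'v \<times> 'w \<Rightarrow> 'v \<times> 'w::ab_group_add) \<Rightarrow> ('v \<Rightarrow> 'w) \<Rightarrow> 'v \<Rightarrow> 'w \<Rightarrow> 'w" where
  "graph_action M g z w = graph_defect g (M (z, g z) (0, w))"

definition graph_curvature ::
    "('v \<times> 'w \<Rightarrow> 'v \<times> 'w \<Rightarrow> 'v \<times> 'w::ab_group_add) \<Rightarrow> ('v \<Rightarrow> 'w) \<Rightarrow> 'v \<Rightarrow> 'v \<Rightarrow> 'w" where
  "graph_curvature M g x y = graph_defect g (M (x, g x) (y, g y))"

text \<open>
  For a Lie bracket \<open>\<beta>\<close> with a representation \<open>\<rho>\<close> this is minus the Chevalley--Eilenberg differential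
  of the 2-cochain \<open>c\<close>.
\<close>

definition twisted_diff ::
    "('v \<Rightarrow> 'v \<Rightarrow> 'v) \<Rightarrow> ('v \<Rightarrow> 'w \<Rightarrow> 'w) \<Rightarrow> ('v \<Rightarrow> 'v \<Rightarrow> 'w::ab_group_add) \<Rightarrow> 'v \<Rightarrow> 'v \<Rightarrow> 'v \<Rightarrow> 'w" where
  "twisted_diff \<beta> \<rho> c x y z =
     (c (\<beta> x y) z - \<rho> z (c x y)) + (c (\<beta> y z) x - \<rho> x (c y z)) + (c (\<beta> z x) y - \<rho> y (c z x))"

lemma lie_subalgebra_graph_iff:
  assumes "Vector_Spaces.linear sV sW g"
  shows "lie_subalgebra (prod_scale sV sW) M (lin_graph g) \<longleftrightarrow> (\<forall>x y. graph_curvature M g x y = 0)"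
proof -
  interpret g: Vector_Spaces.linear sV sW g by fact
  interpret P: vector_space "prod_scale sV sW"
    by (rule vector_space_prod_scale) unfold_locales
  have "P.subspace (lin_graph g)"
    by (rule P.subspaceI) (auto simp: lin_graph_def g.add g.scale zero_prod_def)
  moreover have "q \<in> lin_graph g \<longleftrightarrow> graph_defect g q = 0" for q
    by (cases q) (auto simp: lin_graph_def graph_defect_def)
  moreover have "(\<forall>p\<in>lin_graph g. \<forall>q\<in>lin_graph g. R (M p q)) \<longleftrightarrow> (\<forall>x y. R (M (x, g x) (y, g y)))" for R
    by (auto simp: lin_graph_def)
  ultimately show ?thesis by (simp add: lie_subalgebra_def graph_curvature_def)
qed

lemma lie_morphism_of_subalgebra:
  assumes "Vector_Spaces.linear sV sW g" "lie_subalgebra s (lie_prod \<mu>' \<nu>') (lin_graph g)"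
  shows "lie_morphism sV sW \<mu>' \<nu>' g"
proof -
  have "lie_prod \<mu>' \<nu>' (x, g x) (y, g y) \<in> lin_graph g" for x y
    using assms(2) unfolding lie_subalgebra_def by (auto simp: lin_graph_def)
  then show ?thesis using assms(1) by (auto simp: lie_morphism_def lin_graph_def lie_prod_def)
qed

text \<open>
  Write \<open>M (x, g x) (y, g y) = (\<beta>, g \<beta>) + (0, \<Phi> x y)\<close> with \<open>\<beta>\<close> the graph bracket of \<open>x\<close> and \<open>y\<close>. Bracketing with
  \<open>(z, g z)\<close> and applying \<open>graph_defect g\<close> gives \<open>- \<Phi> \<beta> z\<close> from the first summand and the action of \<open>z\<close> on
  \<open>\<Phi> x y\<close> from the second. The cyclic sum of the left-hand sides vanishes by the Jacobi identity.
\<close>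

lemma graph_curvature_Bianchi:
  assumes M: "M \<in> lie_structures (prod_scale sV sW)" and g: "Vector_Spaces.linear sV sW g"
  shows "twisted_diff (graph_bracket M g) (graph_action M g) (graph_curvature M g) x y z = 0"
proof -
  have Ma: "M \<in> alt_bilinear (prod_scale sV sW)" using M by (simp add: lie_structures_def)
  note Ms = alt_bilinear_simps[OF Ma]
  note gs = linear_map_simps[OF g]
  have skew: "M p q = - M q p" for p q by (rule alternating_skew) (auto simp: Ms)
  have \<pi>: "graph_defect g (p + q) = graph_defect g p + graph_defect g q"
    "graph_defect g (- p) = - graph_defect g p" "graph_defect g 0 = 0" for p q
    by (simp_all add: graph_defect_def gs algebra_simps)
  have key: "graph_curvature M g (graph_bracket M g x y) z - graph_action M g z (graph_curvature M g x y)
    = - graph_defect g (M (z, g z) (M (x, g x) (y, g y)))" for x y z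
  proof -
    let ?\<beta> = "graph_bracket M g x y" and ?c = "graph_curvature M g x y"
    have "M (x, g x) (y, g y) = (?\<beta>, g ?\<beta>) + (0, ?c)"
      by (simp add: graph_bracket_def graph_curvature_def graph_defect_def prod_eq_iff)
    then have "graph_defect g (M (z, g z) (M (x, g x) (y, g y)))
      = graph_defect g (M (z, g z) (?\<beta>, g ?\<beta>)) + graph_defect g (M (z, g z) (0, ?c))"
      by (simp only: Ms \<pi>)
    also have "graph_defect g (M (z, g z) (?\<beta>, g ?\<beta>)) = - graph_curvature M g ?\<beta> z"
      by (subst skew) (simp only: graph_curvature_def \<pi>)
    finally show ?thesis by (simp add: graph_action_def)
  qed
  have "M (x, g x) (M (y, g y) (z, g z)) + M (y, g y) (M (z, g z) (x, g x)) + M (z, g z) (M (x, g x) (y, g y)) = 0"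
    using M by (simp add: lie_structures_def)
  from arg_cong[OF this, of "graph_defect g"] show ?thesis
    unfolding twisted_diff_def key by (simp add: \<pi> algebra_simps minus_unique)
qed

section \<open>The contraction and the Bianchi argument\<close>

text \<open>
  The setting of the theorem with coordinates on \<open>V\<close> and \<open>W\<close> chosen. The numbered norms \<open>n1\<close>, \<open>n2\<close>, \<open>n3\<close>
  are those of linear, bilinear and trilinear maps from \<open>V\<close> to \<open>W\<close>.
\<close>

locale lie_morphism_coordinates =
  V: coordinates sV UNIV I \<xi> b + W: coordinates sW UNIV J \<eta> e
  for sV :: "'k::{real_normed_field, euclidean_space} \<Rightarrow> 'v::ab_group_add \<Rightarrow> 'v"
    and I :: "'i set" and \<xi> b
    and sW :: "'k \<Rightarrow> 'w::ab_group_add \<Rightarrow> 'w"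
    and J :: "'j set" and \<eta> e +
  fixes \<mu> :: "'v \<Rightarrow> 'v \<Rightarrow> 'v" and \<nu> :: "'w \<Rightarrow> 'w \<Rightarrow> 'w" and f :: "'v \<Rightarrow> 'w"
  assumes \<mu>: "\<mu> \<in> lie_structures sV" and \<nu>: "\<nu> \<in> lie_structures sW"
    and f: "lie_morphism sV sW \<mu> \<nu> f"
begin

abbreviation "nV \<equiv> coord_norm I \<xi>"
abbreviation "nW \<equiv> coord_norm J \<eta>"
abbreviation "nP \<equiv> (\<lambda>p. nV (fst p) + nW (snd p))"
abbreviation "n1 \<equiv> lin_norm I b nW"
abbreviation "n2 \<equiv> lin_norm I b n1"
abbreviation "n3 \<equiv> lin_norm I b n2"

abbreviation "Hom \<equiv> linear_maps_into sV sW UNIV"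
abbreviation "Bil \<equiv> linear_maps_into sV (fun_scale sW) Hom"
abbreviation "Tri \<equiv> linear_maps_into sV (fun_scale (fun_scale sW)) Bil"

definition "Alt = {c \<in> Bil. \<forall>x. c x x = 0}"

text \<open>
  The differentials are defined on arbitrary functions, not only on multilinear ones: they are linear
  maps between full function types, where right inverses on subspaces are available.
\<close>

definition d1 :: "('v \<Rightarrow> 'w) \<Rightarrow> 'v \<Rightarrow> 'v \<Rightarrow> 'w" where
  "d1 h = (\<lambda>x y. \<nu> (f x) (h y) + \<nu> (h x) (f y) - h (\<mu> x y))"

definition d2 :: "('v \<Rightarrow> 'v \<Rightarrow> 'w) \<Rightarrow> 'v \<Rightarrow> 'v \<Rightarrow> 'v \<Rightarrow> 'w" where
  "d2 = twisted_diff \<mu> (\<lambda>z. \<nu> (f z))"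

lemmas \<mu>_simps = alt_bilinear_simps[OF \<mu>[unfolded lie_structures_def, THEN CollectD, THEN conjunct1]]
lemmas \<nu>_simps = alt_bilinear_simps[OF \<nu>[unfolded lie_structures_def, THEN CollectD, THEN conjunct1]]

lemma f_linear: "Vector_Spaces.linear sV sW f" and f_bracket: "f (\<mu> x y) = \<nu> (f x) (f y)"
  using f by (auto simp: lie_morphism_def)

lemmas f_simps = linear_map_simps[OF f_linear]
lemmas vs = V.vector_space_axioms W.vector_space_axioms
  vector_space_prod_scale[OF V.vector_space_axioms W.vector_space_axioms]
lemmas fs1 = vector_space_fun_scale[OF W.vector_space_axioms]
lemmas fs2 = vector_space_fun_scale[OF fs1]
lemmas fs3 = vector_space_fun_scale[OF fs2]

lemma nu_linear: "Vector_Spaces.linear sW sW (\<nu> w)" "Vector_Spaces.linear sW sW (\<lambda>w. \<nu> w w')"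
  and mu_linear: "Vector_Spaces.linear sV sV (\<mu> v)" "Vector_Spaces.linear sV sV (\<lambda>v. \<mu> v v')"
  using \<mu> \<nu> by (auto simp: lie_structures_def alt_bilinear_def)

lemma Hom_iff: "h \<in> Hom \<longleftrightarrow> Vector_Spaces.linear sV sW h"
  by (simp add: linear_maps_into_def)

lemma Bil_iff: "c \<in> Bil \<longleftrightarrow> (\<forall>x. Vector_Spaces.linear sV sW (c x)) \<and> (\<forall>y. Vector_Spaces.linear sV sW (\<lambda>x. c x y))"
  unfolding linear_maps_into_def linear_map_into_fun_iff[OF vs(2)] by auto

lemma Tri_iff: "c \<in> Tri \<longleftrightarrow> (\<forall>x y. Vector_Spaces.linear sV sW (c x y)) \<and>
    (\<forall>x z. Vector_Spaces.linear sV sW (\<lambda>y. c x y z)) \<and> (\<forall>y z. Vector_Spaces.linear sV sW (\<lambda>x. c x y z))"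
proof -
  have "c \<in> Tri \<longleftrightarrow> Vector_Spaces.linear sV (fun_scale (fun_scale sW)) c \<and> (\<forall>x. c x \<in> Bil)"
    unfolding linear_maps_into_def[of sV "fun_scale (fun_scale sW)"] by blast
  then show ?thesis
    unfolding linear_map_into_fun_iff[OF fs1] linear_map_into_fun_iff[OF vs(2)] Bil_iff by blast
qed

lemma coordinates_Hom: "\<exists>\<alpha> e'. coordinates (fun_scale sW) Hom (I \<times> J) \<alpha> e' \<and> coord_norm (I \<times> J) \<alpha> = n1"
  by (rule coordinates_linear_maps_lin_norm) unfold_locales

lemma coordinates_Bil: "\<exists>\<alpha> e'. coordinates (fun_scale (fun_scale sW)) Bil (I \<times> (I \<times> J)) \<alpha> e' \<and>
    coord_norm (I \<times> (I \<times> J)) \<alpha> = n2"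
  using coordinates_Hom coordinates_linear_maps_lin_norm[OF V.coordinates_axioms] by metis

lemma coordinates_Tri: "\<exists>\<alpha> e'. coordinates (fun_scale (fun_scale (fun_scale sW))) Tri (I \<times> (I \<times> (I \<times> J))) \<alpha> e' \<and>
    coord_norm (I \<times> (I \<times> (I \<times> J))) \<alpha> = n3"
  using coordinates_Bil coordinates_linear_maps_lin_norm[OF V.coordinates_axioms] by metis

lemma seminorms: "seminorm sV nV" "seminorm sW nW" "seminorm (fun_scale sW) n1"
   "seminorm (fun_scale (fun_scale sW)) n2" "seminorm (fun_scale (fun_scale (fun_scale sW))) n3"
  by (intro seminorm_lin_norm V.seminorm_coord_norm W.seminorm_coord_norm)+

lemma Hom_bound: "h \<in> Hom \<Longrightarrow> nW (h x) \<le> n1 h * nV x"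
  by (rule V.apply_le_lin_norm[OF seminorms(2)]) (simp_all add: Hom_iff)

lemma Bil_bound: "c \<in> Bil \<Longrightarrow> nW (c x y) \<le> n2 c * nV x * nV y"
  by (rule bilinear_le_lin_norm[OF V.coordinates_axioms seminorms(2)]) (auto simp: Bil_iff)

lemma Bil_norm_le:
  assumes "\<And>x y. nW (c x y) \<le> K * nV x * nV y"
  shows "n2 c \<le> real (card I) * (real (card I) * K)"
proof (rule V.lin_norm_le)
  fix x
  have "n1 (c x) \<le> real (card I) * (K * nV x)" by (rule V.lin_norm_le) (rule assms)
  then show "n1 (c x) \<le> real (card I) * K * nV x" by (simp add: mult.assoc)
qed

lemma Tri_norm_le:
  assumes "\<And>x y z. nW (c x y z) \<le> K * nV x * nV y * nV z"
  shows "n3 c \<le> real (card I) * (real (card I) * (real (card I) * K))"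
proof (rule V.lin_norm_le)
  fix x
  have "n2 (c x) \<le> real (card I) * (real (card I) * (K * nV x))" by (rule Bil_norm_le) (rule assms)
  then show "n2 (c x) \<le> real (card I) * (real (card I) * K) * nV x" by (simp add: mult.assoc)
qed

lemma subspace_Alt: "module.subspace (fun_scale (fun_scale sW)) Alt"
proof -
  obtain \<alpha> e' where "coordinates (fun_scale (fun_scale sW)) Bil (I \<times> (I \<times> J)) \<alpha> e'"
    using coordinates_Bil by blast
  then interpret B: coordinates "fun_scale (fun_scale sW)" Bil "I \<times> (I \<times> J)" \<alpha> e' .
  show ?thesis
    using B.subspace_0[OF B.subspace] B.subspace_add[OF B.subspace] B.subspace_scale[OF B.subspace]
    by (intro B.subspaceI) (auto simp: Alt_def fun_scale_def)
qed

lemma Alt_diff: "c \<in> Alt \<Longrightarrow> c' \<in> Alt \<Longrightarrow> c - c' \<in> Alt"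
  using module.subspace_diff[OF _ subspace_Alt] fs2 module_iff_vector_space by blast

lemma Hom_diff: "c \<in> Hom \<Longrightarrow> c' \<in> Hom \<Longrightarrow> c - c' \<in> Hom"
  using linear_map_diff[of sV sW c c'] by (simp add: Hom_iff fun_diff_def)

lemma linear_d1: "Vector_Spaces.linear (fun_scale sW) (fun_scale (fun_scale sW)) d1"
  using fs1 fs2
  by (auto simp: Vector_Spaces.linear_iff d1_def fun_eq_iff fun_scale_def \<nu>_simps algebra_simps
      W.scale_right_distrib W.scale_right_diff_distrib)

lemma linear_d2: "Vector_Spaces.linear (fun_scale (fun_scale sW)) (fun_scale (fun_scale (fun_scale sW))) d2"
  using fs2 fs3
  by (auto simp: Vector_Spaces.linear_iff d2_def twisted_diff_def fun_eq_iff fun_scale_def \<nu>_simps algebra_simps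
      W.scale_right_distrib W.scale_right_diff_distrib)

lemma d1_Alt:
  assumes "h \<in> Hom"
  shows "d1 h \<in> Alt"
proof -
  have h: "Vector_Spaces.linear sV sW h" using assms by (simp add: Hom_iff)
  have "\<nu> (h x) (f x) = - \<nu> (f x) (h x)" for x by (rule alternating_skew) (auto simp: \<nu>_simps)
  then show ?thesis
    unfolding Alt_def d1_def
    by (auto simp: Bil_iff \<mu>_simps linear_map_simps[OF h] intro!: linear_map_add linear_map_diff
        linear_map_compose[OF nu_linear(1)] linear_map_compose[OF nu_linear(2)] linear_map_compose[OF h] h f_linear mu_linear)
qed

text \<open>
  The terms \<open>\<nu> (f z) (h (\<mu> x y))\<close> cancel at once. In the cyclic sum the terms with two brackets of \<open>\<nu>\<close>
  cancel by the Jacobi identity of \<open>\<nu>\<close>, and those inside \<open>h\<close> by that of \<open>\<mu>\<close>.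
\<close>

lemma d2_d1:
  assumes "h \<in> Hom"
  shows "d2 (d1 h) = 0"
proof -
  have h: "Vector_Spaces.linear sV sW h" using assms by (simp add: Hom_iff)
  have muJ: "\<mu> (\<mu> x y) z + \<mu> (\<mu> y z) x + \<mu> (\<mu> z x) y = 0" for x y z
  proof -
    have skew: "\<mu> (\<mu> x y) z = - \<mu> z (\<mu> x y)" for x y z by (rule alternating_skew) (auto simp: \<mu>_simps)
    have "\<mu> x (\<mu> y z) + \<mu> y (\<mu> z x) + \<mu> z (\<mu> x y) = 0" using \<mu> by (simp add: lie_structures_def)
    then show ?thesis by (simp add: skew algebra_simps add_eq_0_iff)
  qed
  have nu_skew: "\<nu> x y = - \<nu> y x" for x y by (rule alternating_skew) (auto simp: \<nu>_simps)
  have nuJ: "\<nu> (\<nu> x y) z = \<nu> x (\<nu> y z) - \<nu> y (\<nu> x z)" for x y z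
  proof -
    have "\<nu> x (\<nu> y z) + \<nu> y (\<nu> z x) + \<nu> z (\<nu> x y) = 0" using \<nu> by (simp add: lie_structures_def)
    then have "- \<nu> z (\<nu> x y) = \<nu> x (\<nu> y z) + \<nu> y (\<nu> z x)"
      by (intro minus_unique) (simp add: algebra_simps)
    then show ?thesis unfolding nu_skew[of "\<nu> x y" z] nu_skew[of x z]
      by (simp add: \<nu>_simps)
  qed
  have step: "d1 h (\<mu> x y) z - \<nu> (f z) (d1 h x y) =
      (\<nu> (f x) (\<nu> (f y) (h z)) - \<nu> (f y) (\<nu> (f x) (h z)) - \<nu> (f z) (\<nu> (f x) (h y)) + \<nu> (f z) (\<nu> (f y) (h x)))
      - h (\<mu> (\<mu> x y) z)" for x y z
    unfolding d1_def f_bracket nuJ using nu_skew[of "h (\<mu> x y)" "f z"] nu_skew[of "h x" "f y"]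
    by (simp add: \<nu>_simps algebra_simps)
  have "d2 (d1 h) x y z = - h (\<mu> (\<mu> x y) z + \<mu> (\<mu> y z) x + \<mu> (\<mu> z x) y)" for x y z
    unfolding d2_def twisted_diff_def step by (simp add: linear_map_simps[OF h] algebra_simps)
  then show ?thesis by (simp add: fun_eq_iff muJ linear_map_simps[OF h])
qed

lemma curvature_Alt:
  assumes M: "M \<in> alt_bilinear (prod_scale sV sW)" and g: "Vector_Spaces.linear sV sW g"
  shows "graph_curvature M g \<in> Alt"
proof -
  have M': "Vector_Spaces.linear (prod_scale sV sW) (prod_scale sV sW) (M p)"
    "Vector_Spaces.linear (prod_scale sV sW) (prod_scale sV sW) (\<lambda>q. M q p)" for p
    using M by (simp_all add: alt_bilinear_def del: split_paired_All)
  have \<pi>: "Vector_Spaces.linear (prod_scale sV sW) sW (graph_defect g)"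
    unfolding graph_defect_def
    by (intro linear_map_diff linear_map_snd linear_map_compose[OF g] linear_map_fst vs)
  have gr: "Vector_Spaces.linear sV (prod_scale sV sW) (\<lambda>x. (x, g x))"
    by (intro linear_map_pair linear_map_id vs g)
  show ?thesis
    unfolding Alt_def graph_curvature_def
    by (auto simp: Bil_iff alt_bilinear_simps(11)[OF M] linear_map_simps(4)[OF \<pi>]
        intro!: linear_map_compose[OF \<pi>] linear_map_compose[OF M'(1) gr] linear_map_compose[OF M'(2) gr])
qed

lemma twisted_diff_Tri:
  assumes c: "c \<in> Bil"
    and \<beta>: "\<And>x. Vector_Spaces.linear sV sV (\<beta> x)" "\<And>y. Vector_Spaces.linear sV sV (\<lambda>x. \<beta> x y)"
    and \<rho>: "\<And>x. Vector_Spaces.linear sW sW (\<rho> x)" "\<And>y. Vector_Spaces.linear sV sW (\<lambda>x. \<rho> x y)"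
  shows "twisted_diff \<beta> \<rho> c \<in> Tri"
proof -
  have c': "Vector_Spaces.linear sV sW (c x)" "Vector_Spaces.linear sV sW (\<lambda>x. c x y)" for x y
    using c by (auto simp: Bil_iff)
  show ?thesis
    unfolding Tri_iff twisted_diff_def
    by (auto intro!: linear_map_add linear_map_diff c' \<rho> linear_map_compose[OF c'(1)] \<beta>
        linear_map_compose[OF c'(2)] linear_map_compose[OF \<rho>(1)])
qed

lemma graph_bracket_linear:
  assumes M: "M \<in> alt_bilinear (prod_scale sV sW)" and g: "Vector_Spaces.linear sV sW g"
  shows "Vector_Spaces.linear sV sV (graph_bracket M g x)" "Vector_Spaces.linear sV sV (\<lambda>x. graph_bracket M g x y)"
    "Vector_Spaces.linear sW sW (graph_action M g x)" "Vector_Spaces.linear sV sW (\<lambda>x. graph_action M g x w)"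
proof -
  have M': "Vector_Spaces.linear (prod_scale sV sW) (prod_scale sV sW) (M p)"
    "Vector_Spaces.linear (prod_scale sV sW) (prod_scale sV sW) (\<lambda>q. M q p)" for p
    using M by (simp_all add: alt_bilinear_def del: split_paired_All)
  have \<pi>: "Vector_Spaces.linear (prod_scale sV sW) sW (graph_defect g)"
    unfolding graph_defect_def
    by (intro linear_map_diff linear_map_snd linear_map_compose[OF g] linear_map_fst vs)
  have gr: "Vector_Spaces.linear sV (prod_scale sV sW) (\<lambda>x. (x, g x))"
    by (intro linear_map_pair linear_map_id vs g)
  have ve: "Vector_Spaces.linear sW (prod_scale sV sW) (\<lambda>w. (0, w))"
    by (intro linear_map_pair linear_map_id linear_map_zero vs)
  note fst = linear_map_fst[OF vs(1,2)]
  show "Vector_Spaces.linear sV sV (graph_bracket M g x)" "Vector_Spaces.linear sV sV (\<lambda>x. graph_bracket M g x y)"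
    "Vector_Spaces.linear sW sW (graph_action M g x)" "Vector_Spaces.linear sV sW (\<lambda>x. graph_action M g x w)"
    unfolding graph_bracket_def graph_action_def
    by (intro linear_map_compose[OF \<pi>] linear_map_compose[OF fst] linear_map_compose[OF M'(1) gr]
        linear_map_compose[OF M'(2) gr] linear_map_compose[OF M'(1) ve])+
qed

text \<open>
  The part of the curvature left over when \<open>d1 h\<close> is removed; \<open>m\<close> stands for \<open>M - \<mu> \<oplus> \<nu>\<close>.
\<close>

definition nonlinear_part :: "('v \<times> 'w \<Rightarrow> 'v \<times> 'w \<Rightarrow> 'v \<times> 'w) \<Rightarrow> ('v \<Rightarrow> 'w) \<Rightarrow> 'v \<Rightarrow> 'v \<Rightarrow> 'w" where
  "nonlinear_part m h x y = \<nu> (h x) (h y) + graph_curvature m (f + h) x y"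

lemma curvature_expansion:
  assumes h: "h \<in> Hom"
  shows "graph_curvature M (f + h) = d1 h + nonlinear_part (M - lie_prod \<mu> \<nu>) h"
proof -
  have h: "Vector_Spaces.linear sV sW h" using assms by (simp add: Hom_iff)
  show ?thesis
    by (simp add: fun_eq_iff nonlinear_part_def d1_def graph_curvature_def graph_defect_def lie_prod_def f_bracket
        f_simps linear_map_simps[OF h] \<nu>_simps algebra_simps)
qed

context
  \<comment> \<open>The estimates for a perturbation \<open>h\<close> of norm at most \<open>r\<close> and a perturbation \<open>m\<close> of the bracket
      of norm at most \<open>\<delta>\<close>. As \<open>F\<close> bounds \<open>f\<close>, the constant \<open>A = F + 2\<close> bounds \<open>x \<mapsto> (x, f x + h x)\<close>.\<close>
  fixes C\<nu> F r \<delta> A :: real and m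
  assumes C\<nu>: "0 \<le> C\<nu>" "\<And>w w'. nW (\<nu> w w') \<le> C\<nu> * nW w * nW w'"
    and F: "0 \<le> F" "\<And>x. nW (f x) \<le> F * nV x"
    and A: "A = F + 2"
    and r: "0 \<le> r" "r \<le> 1" and \<delta>: "0 \<le> \<delta>"
    and m: "m \<in> alt_bilinear (prod_scale sV sW)"
    and m_le: "\<And>p q. nP (m p q) \<le> \<delta> * nP p * nP q"
begin

lemma norms_nonneg: "0 \<le> nV x" "0 \<le> nW w" "0 \<le> n1 h" "0 \<le> n2 c" "0 \<le> A"
  using seminorms[THEN seminorm_nonneg] A F by auto

lemma nu_le:
  assumes "nW w \<le> a" "nW w' \<le> a'"
  shows "nW (\<nu> w w') \<le> C\<nu> * a * a'"
proof -
  have "C\<nu> * nW w * nW w' \<le> C\<nu> * a * a'"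
    using assms C\<nu>(1) norms_nonneg order_trans[OF norms_nonneg(2) assms(1)] by (intro mult_mono mult_nonneg_nonneg) auto
  then show ?thesis using C\<nu>(2)[of w w'] by linarith
qed

lemma small_bracket_le:
  assumes "nP p \<le> a" "nP q \<le> a'"
  shows "nP (m p q) \<le> \<delta> * a * a'"
proof -
  have "\<delta> * nP p * nP q \<le> \<delta> * a * a'"
    using assms \<delta> norms_nonneg order_trans[OF _ assms(1)] by (intro mult_mono mult_nonneg_nonneg add_nonneg_nonneg) auto
  then show ?thesis using m_le[of p q] by linarith
qed

lemma perturbed_graph_le:
  assumes "h \<in> Hom" "n1 h \<le> r"
  shows "nP (x, (f + h) x) \<le> A * nV x" "nW (graph_defect (f + h) q) \<le> A * nP q" "nW (h x) \<le> r * nV x"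
proof -
  have h: "nW (h x) \<le> r * nV x" for x
    using Hom_bound[OF assms(1), of x] mult_right_mono[OF assms(2) norms_nonneg(1)[of x]] by linarith
  then show "nW (h x) \<le> r * nV x" .
  have g: "nW ((f + h) x) \<le> (F + 1) * nV x" for x
    using seminorm_triangle[OF seminorms(2), of "f x" "h x"] h[of x] F(2)[of x]
      mult_right_mono[OF r(2) norms_nonneg(1)[of x]] by (simp add: algebra_simps)
  then show "nP (x, (f + h) x) \<le> A * nV x" using g[of x] by (simp add: A algebra_simps)
  have "nW (graph_defect (f + h) q) \<le> nW (snd q) + nW ((f + h) (fst q))"
    unfolding graph_defect_def by (rule seminorm_diff[OF seminorms(2)])
  also have "\<dots> \<le> nW (snd q) + (F + 1) * nV (fst q)" using g by simp
  also have "\<dots> \<le> A * nP q"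
    using mult_nonneg_nonneg[OF F(1) norms_nonneg(2)[of "snd q"]] norms_nonneg(1)[of "fst q"] norms_nonneg(2)[of "snd q"]
    by (simp add: A algebra_simps)
  finally show "nW (graph_defect (f + h) q) \<le> A * nP q" .
qed

lemma nonlinear_part_0_le: "nW (nonlinear_part m 0 x y) \<le> A ^ 3 * \<delta> * nV x * nV y"
proof -
  have 0: "0 \<in> Hom" "n1 0 \<le> r"
    using r(1) seminorm_zero[OF seminorms(3)] linear_map_zero[OF vs(1,2)] by (simp_all add: Hom_iff zero_fun_def)
  note f_h = perturbed_graph_le[OF 0]
  have "nP (m (x, (f + 0) x) (y, (f + 0) y)) \<le> \<delta> * (A * nV x) * (A * nV y)"
    by (rule small_bracket_le[OF f_h(1) f_h(1)])
  from mult_left_mono[OF this norms_nonneg(5)]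
  show ?thesis
    using f_h(2)[of "m (x, (f + 0) x) (y, (f + 0) y)"]
    by (simp add: nonlinear_part_def graph_curvature_def \<nu>_simps power3_eq_cube mult_ac)
qed

text \<open>
  The Lipschitz constant tends to \<open>0\<close> with \<open>r\<close> and \<open>\<delta>\<close>: telescoping each product replaces one factor
  \<open>h\<close> by \<open>h - h'\<close>, and the remaining factors contribute an \<open>r\<close> (from \<open>\<nu>\<close>) or a \<open>\<delta>\<close> (from \<open>m\<close>).
\<close>

lemma nonlinear_part_diff_le:
  assumes h: "h \<in> Hom" "n1 h \<le> r" and h': "h' \<in> Hom" "n1 h' \<le> r"
  shows "nW ((nonlinear_part m h - nonlinear_part m h') x y) \<le> (2 * C\<nu> * r + 3 * A ^ 2 * \<delta>) * n1 (h - h') * nV x * nV y"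
proof -
  define d where "d = n1 (h - h')"
  have dh: "nW (h x - h' x) \<le> d * nV x" for x
    using Hom_bound[OF Hom_diff[OF h(1) h'(1)], of x] by (simp add: d_def)
  have d0: "0 \<le> d" by (simp add: d_def norms_nonneg)
  let ?g = "f + h" and ?g' = "f + h'"
  let ?a = "m (x, ?g x) (y, ?g y)" and ?a' = "m (x, ?g' x) (y, ?g' y)"
  note ms = alt_bilinear_simps[OF m]
  have 1: "\<nu> (h x) (h y) - \<nu> (h' x) (h' y) = \<nu> (h x - h' x) (h y) + \<nu> (h' x) (h y - h' y)"
    by (simp add: \<nu>_simps)
  have 2: "?a - ?a' = m (0, h x - h' x) (y, ?g y) + m (x, ?g' x) (0, h y - h' y)"
  proof -
    have "(0, h x - h' x) = (x, ?g x) - (x, ?g' x)" for x by simp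
    then show ?thesis by (simp only: ms) simp
  qed
  have 3: "graph_defect ?g ?a - graph_defect ?g' ?a' = graph_defect ?g (?a - ?a') - (h (fst ?a') - h' (fst ?a'))"
    using h(1) by (simp add: graph_defect_def f_simps linear_map_simps[of sV sW h] Hom_iff)
  have n\<nu>: "nW (\<nu> (h x) (h y) - \<nu> (h' x) (h' y)) \<le> C\<nu> * (d * nV x) * (r * nV y) + C\<nu> * (r * nV x) * (d * nV y)"
    unfolding 1 by (intro order_trans[OF seminorm_triangle[OF seminorms(2)]] add_mono nu_le dh perturbed_graph_le h h')
  have "nP (?a - ?a') \<le> nP (m (0, h x - h' x) (y, ?g y)) + nP (m (x, ?g' x) (0, h y - h' y))"
    unfolding 2 using seminorm_triangle[OF seminorms(1)] seminorm_triangle[OF seminorms(2)]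
    by (smt (verit) fst_add snd_add)
  also have "\<dots> \<le> \<delta> * (d * nV x) * (A * nV y) + \<delta> * (A * nV x) * (d * nV y)"
    using dh seminorm_zero[OF seminorms(1)] by (intro add_mono small_bracket_le perturbed_graph_le h h') auto
  finally have na: "nP (?a - ?a') \<le> \<delta> * (d * nV x) * (A * nV y) + \<delta> * (A * nV x) * (d * nV y)" .
  have na': "nP ?a' \<le> \<delta> * (A * nV x) * (A * nV y)" by (intro small_bracket_le perturbed_graph_le h')
  have "nW (h (fst ?a') - h' (fst ?a')) \<le> d * nV (fst ?a')" by (rule dh)
  also have "\<dots> \<le> d * (\<delta> * (A * nV x) * (A * nV y))"
    using na' norms_nonneg(2)[of "snd ?a'"] by (intro mult_left_mono d0) linarith
  finally have n3: "nW (h (fst ?a') - h' (fst ?a')) \<le> d * (\<delta> * (A * nV x) * (A * nV y))" .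
  have n4: "nW (graph_defect ?g (?a - ?a')) \<le> A * (\<delta> * (d * nV x) * (A * nV y) + \<delta> * (A * nV x) * (d * nV y))"
    using perturbed_graph_le(2)[OF h, of "?a - ?a'"] mult_left_mono[OF na norms_nonneg(5)] by linarith
  have eq: "(nonlinear_part m h - nonlinear_part m h') x y = (\<nu> (h x) (h y) - \<nu> (h' x) (h' y)) + (graph_defect ?g (?a - ?a') - (h (fst ?a') - h' (fst ?a')))"
    unfolding 3[symmetric] by (simp add: nonlinear_part_def graph_curvature_def)
  have "nW ((nonlinear_part m h - nonlinear_part m h') x y) \<le> nW (\<nu> (h x) (h y) - \<nu> (h' x) (h' y)) +
      (nW (graph_defect ?g (?a - ?a')) + nW (h (fst ?a') - h' (fst ?a')))"
    unfolding eq
    by (intro order_trans[OF seminorm_triangle[OF seminorms(2)]] add_mono seminorm_diff[OF seminorms(2)] order_refl)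
  also have "\<dots> \<le> (C\<nu> * (d * nV x) * (r * nV y) + C\<nu> * (r * nV x) * (d * nV y)) +
      (A * (\<delta> * (d * nV x) * (A * nV y) + \<delta> * (A * nV x) * (d * nV y)) + d * (\<delta> * (A * nV x) * (A * nV y)))"
    by (intro add_mono n\<nu> n3 n4)
  also have "\<dots> = (2 * C\<nu> * r + 3 * A ^ 2 * \<delta>) * d * nV x * nV y"
    by (simp add: power2_eq_square algebra_simps)
  finally show ?thesis by (simp add: d_def)
qed

text \<open>
  The bracket and the action of the perturbed graph differ from \<open>\<mu>\<close> and \<open>w \<mapsto> \<nu> (f z) w\<close> by terms that are
  small with \<open>\<delta>\<close>, and \<open>\<nu> (h z) w\<close>, which is small with \<open>r\<close>.
\<close>

lemma twisted_diff_le: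
  assumes h: "h \<in> Hom" "n1 h \<le> r" and c: "c \<in> Bil" and M: "M = lie_prod \<mu> \<nu> + m"
  shows "nW ((d2 c - twisted_diff (graph_bracket M (f + h)) (graph_action M (f + h)) c) x y z)
    \<le> 3 * (2 * A ^ 2 * \<delta> + C\<nu> * r) * n2 c * nV x * nV y * nV z"
proof -
  let ?g = "f + h"
  have c': "Vector_Spaces.linear sV sW (c x)" "Vector_Spaces.linear sV sW (\<lambda>x. c x y)" for x y
    using c by (auto simp: Bil_iff)
  define \<beta> where "\<beta> x y = fst (m (x, ?g x) (y, ?g y))" for x y
  define \<rho> where "\<rho> z w = \<nu> (h z) w + graph_defect ?g (m (z, ?g z) (0, w))" for z w
  have \<beta>: "graph_bracket M ?g x y = \<mu> x y + \<beta> x y" for x y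
    by (simp add: graph_bracket_def M \<beta>_def lie_prod_def)
  have \<rho>: "graph_action M ?g z w = \<nu> (f z) w + \<rho> z w" for z w
    using h(1) by (simp add: graph_action_def M \<rho>_def lie_prod_def graph_defect_def \<mu>_simps \<nu>_simps f_simps Hom_iff
        linear_map_simps[of sV sW h])
  have eq: "(d2 c - twisted_diff (graph_bracket M ?g) (graph_action M ?g) c) x y z =
    - ((c (\<beta> x y) z - \<rho> z (c x y)) + (c (\<beta> y z) x - \<rho> x (c y z)) + (c (\<beta> z x) y - \<rho> y (c z x)))"
    by (simp add: d2_def twisted_diff_def \<beta> \<rho> linear_map_simps(1)[OF c'(2)] algebra_simps)
  have T: "nW (c (\<beta> x y) z - \<rho> z (c x y)) \<le> (2 * A ^ 2 * \<delta> + C\<nu> * r) * n2 c * nV x * nV y * nV z" for x y z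
  proof -
    have "nP (m (x, ?g x) (y, ?g y)) \<le> \<delta> * (A * nV x) * (A * nV y)" by (intro small_bracket_le perturbed_graph_le h)
    then have "nV (\<beta> x y) \<le> \<delta> * (A * nV x) * (A * nV y)"
      using norms_nonneg(2)[of "snd (m (x, ?g x) (y, ?g y))"] unfolding \<beta>_def by linarith
    then have 1: "nW (c (\<beta> x y) z) \<le> n2 c * (\<delta> * (A * nV x) * (A * nV y)) * nV z"
      using Bil_bound[OF c, of "\<beta> x y" z] by (meson mult_left_mono mult_right_mono norms_nonneg order_trans)
    have cxy: "nW (c x y) \<le> n2 c * nV x * nV y" by (rule Bil_bound[OF c])
    have "nP (m (z, ?g z) (0, c x y)) \<le> \<delta> * (A * nV z) * (n2 c * nV x * nV y)"
      using cxy seminorm_zero[OF seminorms(1)] by (intro small_bracket_le perturbed_graph_le h) auto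
    then have 2: "nW (graph_defect ?g (m (z, ?g z) (0, c x y))) \<le> A * (\<delta> * (A * nV z) * (n2 c * nV x * nV y))"
      using perturbed_graph_le(2)[OF h] by (meson mult_left_mono norms_nonneg order_trans)
    have 3: "nW (\<nu> (h z) (c x y)) \<le> C\<nu> * (r * nV z) * (n2 c * nV x * nV y)"
      by (intro nu_le perturbed_graph_le h cxy)
    have "nW (c (\<beta> x y) z - \<rho> z (c x y)) \<le> nW (c (\<beta> x y) z) +
      (nW (\<nu> (h z) (c x y)) + nW (graph_defect ?g (m (z, ?g z) (0, c x y))))"
      unfolding \<rho>_def
      by (intro order_trans[OF seminorm_diff[OF seminorms(2)]] add_mono seminorm_triangle[OF seminorms(2)] order_refl)
    also have "\<dots> \<le> n2 c * (\<delta> * (A * nV x) * (A * nV y)) * nV z +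
      (C\<nu> * (r * nV z) * (n2 c * nV x * nV y) + A * (\<delta> * (A * nV z) * (n2 c * nV x * nV y)))"
      by (intro add_mono 1 2 3)
    also have "\<dots> = (2 * A ^ 2 * \<delta> + C\<nu> * r) * n2 c * nV x * nV y * nV z"
      by (simp add: power2_eq_square algebra_simps)
    finally show ?thesis .
  qed
  have "nW ((d2 c - twisted_diff (graph_bracket M ?g) (graph_action M ?g) c) x y z)
    \<le> nW (c (\<beta> x y) z - \<rho> z (c x y)) + nW (c (\<beta> y z) x - \<rho> x (c y z)) + nW (c (\<beta> z x) y - \<rho> y (c z x))"
    unfolding eq seminorm_minus[OF seminorms(2)]
    by (intro order_trans[OF seminorm_triangle[OF seminorms(2)]] add_mono seminorm_triangle[OF seminorms(2)] order_refl)
  also have "\<dots> \<le> 3 * (2 * A ^ 2 * \<delta> + C\<nu> * r) * n2 c * nV x * nV y * nV z"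
  proof -
    define B where "B = (2 * A ^ 2 * \<delta> + C\<nu> * r) * n2 c * nV x * nV y * nV z"
    have "nW (c (\<beta> y z) x - \<rho> x (c y z)) \<le> B" "nW (c (\<beta> z x) y - \<rho> y (c z x)) \<le> B"
      using T[of y z x] T[of z x y] by (simp_all add: B_def mult_ac)
    moreover have "nW (c (\<beta> x y) z - \<rho> z (c x y)) \<le> B" using T[of x y z] by (simp add: B_def)
    moreover have "3 * (2 * A ^ 2 * \<delta> + C\<nu> * r) * n2 c * nV x * nV y * nV z = 3 * B"
      by (simp add: B_def mult.assoc)
    ultimately show ?thesis by linarith
  qed
  finally show ?thesis .
qed

end

lemma lie_prod_alt_bilinear: "lie_prod \<mu> \<nu> \<in> alt_bilinear (prod_scale sV sW)"
  using vs(3) by (simp add: alt_bilinear_def lie_prod_def Vector_Spaces.linear_iff \<mu>_simps \<nu>_simps zero_prod_def)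

text \<open>
  The contraction and the Bianchi argument. For the self-map property of the ball, half of the
  radius is used up by the contraction factor \<open>1/2\<close> and half is left for the image of \<open>0\<close>,
  which is small with \<open>\<delta>\<close>; therefore \<open>r\<close> is chosen before \<open>\<delta>\<close>.
\<close>

theorem deformation_exists:
  assumes exact: "\<And>c. c \<in> Alt \<Longrightarrow> d2 c = 0 \<Longrightarrow> c \<in> d1 ` Hom"
    and \<epsilon>: "0 < \<epsilon>"
  shows "\<exists>\<delta>>0. \<forall>M\<in>lie_structures (prod_scale sV sW).
    (\<forall>p q. nP ((M - lie_prod \<mu> \<nu>) p q) \<le> \<delta> * nP p * nP q) \<longrightarrow>
    (\<exists>h\<in>Hom. n1 h < \<epsilon> \<and> lie_subalgebra (prod_scale sV sW) M (lin_graph (f + h)))"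
proof -
  interpret VP1: vector_space_pair "fun_scale sW" "fun_scale (fun_scale sW)"
    using fs1 fs2 by (simp add: vector_space_pair_def)
  interpret VP2: vector_space_pair "fun_scale (fun_scale sW)" "fun_scale (fun_scale (fun_scale sW))"
    using fs2 fs3 by (simp add: vector_space_pair_def)
  obtain \<alpha>1 e1 where c1: "coordinates (fun_scale sW) Hom (I \<times> J) \<alpha>1 e1" and n1: "coord_norm (I \<times> J) \<alpha>1 = n1"
    using coordinates_Hom by blast
  interpret C1: coordinates "fun_scale sW" Hom "I \<times> J" \<alpha>1 e1 by (rule c1)
  obtain \<alpha>2 e2 where c2: "coordinates (fun_scale (fun_scale sW)) Bil (I \<times> (I \<times> J)) \<alpha>2 e2"
      and n2: "coord_norm (I \<times> (I \<times> J)) \<alpha>2 = n2"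
    using coordinates_Bil by blast
  interpret C2: coordinates "fun_scale (fun_scale sW)" Bil "I \<times> (I \<times> J)" \<alpha>2 e2 by (rule c2)
  obtain \<alpha>3 e3 where c3: "coordinates (fun_scale (fun_scale (fun_scale sW))) Tri (I \<times> (I \<times> (I \<times> J))) \<alpha>3 e3"
      and n3: "coord_norm (I \<times> (I \<times> (I \<times> J))) \<alpha>3 = n3"
    using coordinates_Tri by blast
  interpret C3: coordinates "fun_scale (fun_scale (fun_scale sW))" Tri "I \<times> (I \<times> (I \<times> J))" \<alpha>3 e3 by (rule c3)
  obtain k where k: "range k \<subseteq> Hom" "Vector_Spaces.linear (fun_scale (fun_scale sW)) (fun_scale sW) k"
      "\<And>c. c \<in> d1 ` Hom \<Longrightarrow> d1 (k c) = c"
    using VP1.linear_exists_right_inverse_on[OF linear_d1 C1.subspace] by blast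
  obtain K where K: "range K \<subseteq> Alt"
      "Vector_Spaces.linear (fun_scale (fun_scale (fun_scale sW))) (fun_scale (fun_scale sW)) K"
      "\<And>c. c \<in> d2 ` Alt \<Longrightarrow> d2 (K c) = c"
    using VP2.linear_exists_right_inverse_on[OF linear_d2 subspace_Alt] by blast
  have Alt_Bil: "c \<in> Bil" if "c \<in> Alt" for c using that by (simp add: Alt_def)
  \<comment> \<open>\<open>P\<close> maps \<open>Alt\<close> into \<open>ker d2\<close> and fixes \<open>ker d2\<close>; by exactness its values on \<open>Alt\<close> lie in \<open>im d1\<close>.\<close>
  define P where "P c = c - K (d2 c)" for c
  define G where "G c = k (P c)" for c
  have P_exact: "P c \<in> d1 ` Hom" if "c \<in> Alt" for c
    using that K(1) K(3)[of "d2 c"] by (intro exact) (auto simp: P_def linear_map_simps[OF linear_d2] intro!: Alt_diff)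
  have lin_G: "Vector_Spaces.linear (fun_scale (fun_scale sW)) (fun_scale sW) G"
    unfolding G_def P_def
    by (intro linear_map_compose[OF k(2)] linear_map_diff linear_map_id linear_map_compose[OF K(2)] linear_d2 fs2)

  define CG where "CG = (\<Sum>j\<in>I \<times> (I \<times> J). n1 (G (e2 j)))"
  define CK where "CK = (\<Sum>j\<in>I \<times> (I \<times> (I \<times> J)). n2 (K (e3 j)))"
  define C\<nu> where "C\<nu> = lin_norm J e (lin_norm J e nW) \<nu>"
  define F where "F = lin_norm I b nW f"
  define A where "A = F + 2"
  define N where "N = real (card I)"
  note nn = seminorms[THEN seminorm_nonneg]
  have G_le: "n1 (G c) \<le> CG * n2 c" if "c \<in> Bil" for c
    using C2.seminorm_linear_le[OF seminorms(3) lin_G that] by (simp add: CG_def n2)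
  have K_le: "n2 (K c) \<le> CK * n3 c" if "c \<in> Tri" for c
    using C3.seminorm_linear_le[OF seminorms(4) K(2) that] by (simp add: CK_def n3)
  have \<nu>_le: "nW (\<nu> w w') \<le> C\<nu> * nW w * nW w'" for w w'
    unfolding C\<nu>_def by (rule bilinear_le_lin_norm[OF W.coordinates_axioms seminorms(2)]) (rule nu_linear)+
  have F_le: "nW (f x) \<le> F * nV x" for x
    unfolding F_def by (rule Hom_bound) (simp add: Hom_iff f_linear)
  have pos: "0 \<le> CG" "0 \<le> CK" "0 \<le> C\<nu>" "0 \<le> F" "0 \<le> A" "0 \<le> N"
    by (auto simp: CG_def CK_def C\<nu>_def F_def A_def N_def intro!: sum_nonneg nn add_nonneg_nonneg
        seminorm_nonneg[OF seminorm_lin_norm[OF seminorm_lin_norm[OF seminorms(2)]]])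

  \<comment> \<open>The Lipschitz constant of the iteration will be \<open>a1 * r + a2 * \<delta>\<close>, the norm of the image of \<open>0\<close> at most
    \<open>a3 * \<delta>\<close>, and the factor in the Bianchi argument \<open>b1 * r + b2 * \<delta>\<close>.\<close>
  define a1 where "a1 = CG * (N * (N * (2 * C\<nu>)))"
  define a2 where "a2 = CG * (N * (N * (3 * A ^ 2)))"
  define a3 where "a3 = CG * (N * (N * A ^ 3))"
  define b1 where "b1 = CK * (N * (N * (N * (3 * C\<nu>))))"
  define b2 where "b2 = CK * (N * (N * (N * (6 * A ^ 2))))"
  have ab: "0 \<le> a1" "0 \<le> a2" "0 \<le> a3" "0 \<le> b1" "0 \<le> b2"
    using pos by (simp_all add: a1_def a2_def a3_def b1_def b2_def)
  have small: "a * min B (1 / (4 * (1 + a + b'))) \<le> 1/4" "b' * min B (1 / (4 * (1 + a + b'))) \<le> 1/4"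
    if "0 \<le> a" "0 \<le> b'" for a b' B :: real
  proof -
    have "a * min B (1 / (4 * (1 + a + b'))) \<le> a * (1 / (4 * (1 + a + b')))"
      "b' * min B (1 / (4 * (1 + a + b'))) \<le> b' * (1 / (4 * (1 + a + b')))"
      using that by (simp_all only: mult_left_mono min.cobounded2)
    moreover have "a * (1 / (4 * (1 + a + b'))) \<le> 1/4" "b' * (1 / (4 * (1 + a + b'))) \<le> 1/4"
      using that by (simp_all add: field_simps)
    ultimately show "a * min B (1 / (4 * (1 + a + b'))) \<le> 1/4" "b' * min B (1 / (4 * (1 + a + b'))) \<le> 1/4"
      by linarith+
  qed
  define r where "r = min (min 1 (\<epsilon> / 2)) (1 / (4 * (1 + a1 + b1)))"
  define \<delta> where "\<delta> = min (r / (2 * (1 + a3))) (1 / (4 * (1 + a2 + b2)))"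
  have "r \<le> min 1 (\<epsilon> / 2)" unfolding r_def by (rule min.cobounded1)
  moreover have "0 < r" using \<epsilon> ab by (simp add: r_def)
  ultimately have r: "0 < r" "r \<le> 1" "r < \<epsilon>" "a1 * r \<le> 1/4" "b1 * r \<le> 1/4"
    using \<epsilon> small[OF ab(1,4), folded r_def] by (auto simp: r_def)
  have "0 < \<delta>" using r(1) ab by (simp add: \<delta>_def)
  then have \<delta>: "0 < \<delta>" "a2 * \<delta> \<le> 1/4" "b2 * \<delta> \<le> 1/4"
    using small[OF ab(2,5)] by (auto simp: \<delta>_def)
  have "a3 * \<delta> \<le> a3 * (r / (2 * (1 + a3)))"
    using ab by (simp only: \<delta>_def mult_left_mono min.cobounded1)
  also have "\<dots> \<le> r / 2" using ab r(1) by (simp add: field_simps)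
  finally have a3: "a3 * \<delta> \<le> r / 2" .

  show ?thesis
  proof (intro exI[of _ \<delta>] conjI ballI impI \<delta>(1))
    fix M assume M: "M \<in> lie_structures (prod_scale sV sW)"
      and M_le: "\<forall>p q. nP ((M - lie_prod \<mu> \<nu>) p q) \<le> \<delta> * nP p * nP q"
    define m where "m = M - lie_prod \<mu> \<nu>"
    have M_alt: "M \<in> alt_bilinear (prod_scale sV sW)" using M by (simp add: lie_structures_def)
    have m: "m \<in> alt_bilinear (prod_scale sV sW)"
      unfolding m_def by (rule alt_bilinear_diff[OF M_alt lie_prod_alt_bilinear])
    note est = pos(3) \<nu>_le pos(4) F_le A_def less_imp_le[OF r(1)] r(2) less_imp_le[OF \<delta>(1)] m M_le[rule_format, folded m_def]
    have lin: "Vector_Spaces.linear sV sW (f + h)" if "h \<in> Hom" for h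
      using linear_map_add[OF f_linear, of h] that by (simp add: Hom_iff plus_fun_def)
    have curv: "graph_curvature M (f + h) \<in> Alt" if "h \<in> Hom" for h
      by (rule curvature_Alt[OF M_alt lin[OF that]])
    define g where "g h = G (d1 h - graph_curvature M (f + h))" for h
    have remainder_eq: "d1 h - graph_curvature M (f + h) = - nonlinear_part m h" if "h \<in> Hom" for h
      unfolding curvature_expansion[OF that] m_def by simp
    have nonlinear_part_Bil: "nonlinear_part m h \<in> Bil" if "h \<in> Hom" for h
      using Alt_Bil[OF Alt_diff[OF curv[OF that] d1_Alt[OF that]]] remainder_eq[OF that] by (metis minus_diff_eq minus_minus)
    have zero: "0 \<in> Hom" "n1 0 \<le> r"
      using VP1.vs1.subspace_0[OF C1.subspace] r(1) seminorm_zero[OF seminorms(3)] by simp_all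
    have contr: "n1 (g h - g h') \<le> n1 (h - h') / 2"
      if h: "h \<in> Hom" "n1 h \<le> r" and h': "h' \<in> Hom" "n1 h' \<le> r" for h h'
    proof -
      have "g h - g h' = - G (nonlinear_part m h - nonlinear_part m h')"
        unfolding g_def remainder_eq[OF h(1)] remainder_eq[OF h'(1)] by (simp add: linear_map_simps[OF lin_G])
      then have "n1 (g h - g h') = n1 (G (nonlinear_part m h - nonlinear_part m h'))" by (simp add: seminorm_minus[OF seminorms(3)])
      also have "\<dots> \<le> CG * n2 (nonlinear_part m h - nonlinear_part m h')"
        by (intro G_le VP1.vs2.subspace_diff[OF C2.subspace] nonlinear_part_Bil h h')
      also have "\<dots> \<le> CG * (N * (N * ((2 * C\<nu> * r + 3 * A ^ 2 * \<delta>) * n1 (h - h'))))"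
        unfolding N_def by (rule mult_left_mono[OF Bil_norm_le pos(1)]) (rule nonlinear_part_diff_le[OF est h h'])
      finally have "n1 (g h - g h') \<le> (a1 * r + a2 * \<delta>) * n1 (h - h')"
        by (simp add: a1_def a2_def algebra_simps)
      also have "\<dots> \<le> (1 / 2) * n1 (h - h')"
        using r(4) \<delta>(2) by (intro mult_right_mono nn) linarith
      finally show ?thesis by simp
    qed
    have "n1 (g 0) \<le> CG * n2 (nonlinear_part m 0)"
      using G_le[OF nonlinear_part_Bil[OF zero(1)]] unfolding g_def remainder_eq[OF zero(1)]
      by (simp add: linear_map_simps[OF lin_G] seminorm_minus[OF seminorms(3)])
    also have "\<dots> \<le> CG * (N * (N * (A ^ 3 * \<delta>)))"
      unfolding N_def by (rule mult_left_mono[OF Bil_norm_le pos(1)]) (rule nonlinear_part_0_le[OF est])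
    finally have g0: "n1 (g 0) \<le> r / 2"
      using a3 by (simp add: a3_def algebra_simps)
    have "\<exists>h\<in>Hom. n1 h \<le> r \<and> g h = h"
      unfolding n1[symmetric]
    proof (rule coord_norm_contraction_fixpoint[OF c1], unfold n1)
      show "0 \<le> r" using r(1) by simp
      fix h assume h: "h \<in> Hom" "n1 h \<le> r"
      have "n1 (g h) \<le> n1 (g h - g 0) + n1 (g 0)"
        using seminorm_triangle[OF seminorms(3), of "g h - g 0" "g 0"] by simp
      then have "n1 (g h) \<le> r" using contr[OF h zero] g0 h(2) by simp
      moreover have "g h \<in> Hom" using k(1) by (auto simp: g_def G_def)
      ultimately show "g h \<in> Hom \<and> n1 (g h) \<le> r" by blast
    qed (rule contr)
    then obtain h where h: "h \<in> Hom" "n1 h \<le> r" "g h = h" by blast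
    let ?c = "graph_curvature M (f + h)"
    have c: "?c \<in> Alt" by (rule curv[OF h(1)])
    \<comment> \<open>Apply \<open>d1\<close> to the fixed point equation; \<open>P\<close> fixes \<open>d1 h\<close> because \<open>d2 (d1 h) = 0\<close>.\<close>
    have "d1 h = d1 (k (P (d1 h - ?c)))" using h(3) by (simp add: g_def G_def)
    also have "\<dots> = P (d1 h - ?c)" by (intro k(3) P_exact Alt_diff d1_Alt h c)
    also have "\<dots> = d1 h - P ?c"
      by (simp add: P_def linear_map_simps[OF linear_d2] linear_map_simps[OF K(2)] d2_d1[OF h(1)])
    finally have "P ?c = 0" by simp
    then have cK: "?c = K (d2 ?c)" by (simp add: P_def)
    \<comment> \<open>The Bianchi identity allows \<open>D\<close> to be subtracted from \<open>d2\<close> inside \<open>K\<close>.\<close>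
    let ?D = "twisted_diff (graph_bracket M (f + h)) (graph_action M (f + h)) ?c"
    have D0: "?D = 0"
      using graph_curvature_Bianchi[OF M lin[OF h(1)]] by (simp add: fun_eq_iff)
    have Tri: "d2 ?c - ?D \<in> Tri"
      unfolding d2_def
      by (intro VP2.vs2.subspace_diff[OF C3.subspace] twisted_diff_Tri Alt_Bil c graph_bracket_linear[OF M_alt lin[OF h(1)]]
          mu_linear nu_linear linear_map_compose[OF nu_linear(2) f_linear])
    have "n2 ?c = n2 (K (d2 ?c - ?D))" using cK by (simp add: D0)
    also have "\<dots> \<le> CK * n3 (d2 ?c - ?D)" by (rule K_le[OF Tri])
    also have "\<dots> \<le> CK * (N * (N * (N * (3 * (2 * A ^ 2 * \<delta> + C\<nu> * r) * n2 ?c))))"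
      unfolding N_def
      by (rule mult_left_mono[OF Tri_norm_le pos(2)]) (rule twisted_diff_le[OF est h(1,2) Alt_Bil[OF c]], simp add: m_def fun_eq_iff)
    finally have "n2 ?c \<le> (b2 * \<delta> + b1 * r) * n2 ?c"
      by (simp add: b1_def b2_def algebra_simps)
    also have "\<dots> \<le> (1 / 2) * n2 ?c"
      using r(5) \<delta>(3) by (intro mult_right_mono nn) linarith
    finally have "n2 ?c = 0" using nn(4)[of ?c] by simp
    then have "?c = 0" using C2.coord_norm_eq_0[OF Alt_Bil[OF c]] by (simp add: n2)
    then have "lie_subalgebra (prod_scale sV sW) M (lin_graph (f + h))"
      using lie_subalgebra_graph_iff[OF lin[OF h(1)]] by simp
    moreover have "n1 h < \<epsilon>" using h(2) r(3) by simp
    ultimately show "\<exists>h\<in>Hom. n1 h < \<epsilon> \<and> lie_subalgebra (prod_scale sV sW) M (lin_graph (f + h))"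
      using h(1) by blast
  qed
qed

end

section \<open>Chevalley--Eilenberg cohomology of the graph\<close>

context lie_morphism_coordinates
begin

abbreviation "VW \<equiv> vspace_on (prod_scale sV sW) UNIV"
abbreviation "L \<equiv> vspace_on (prod_scale sV sW) (lin_graph f)"
abbreviation "E \<equiv> quotient_space VW (lin_graph f)"
abbreviation "\<rho> \<equiv> quotient_rep VW (lie_prod \<mu> \<nu>) (lin_graph f)"
abbreviation "br \<equiv> lie_prod \<mu> \<nu>"

text \<open>
  The identification of \<open>W\<close> with the quotient by the graph; \<open>value_coset w\<close> is the coset of \<open>(0, w)\<close>.
\<close>

definition value_coset :: "'w \<Rightarrow> ('v \<times> 'w) set" where
  "value_coset w = {p. graph_defect f p = w}"

lemma value_coset_iff: "p \<in> value_coset w \<longleftrightarrow> graph_defect f p = w"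
  by (simp add: value_coset_def)

lemma in_value_coset: "(0, w) \<in> value_coset w"
  by (simp add: value_coset_def graph_defect_def f_simps)

lemma value_coset_eq_iff: "value_coset w = value_coset w' \<longleftrightarrow> w = w'"
  using in_value_coset[of w] by (auto simp: value_coset_iff)

lemma graph_eq_value_coset: "lin_graph f = value_coset 0"
  by (auto simp: lin_graph_def value_coset_def graph_defect_def)

lemma defect_simps: "graph_defect f (p + q) = graph_defect f p + graph_defect f q"
  "graph_defect f (p - q) = graph_defect f p - graph_defect f q"
  "graph_defect f (sV c x, sW c w) = sW c (graph_defect f (x, w))"
  by (simp_all add: graph_defect_def f_simps W.scale_right_diff_distrib)

lemma coset_VW: "lin_graph f +>\<^bsub>VW\<^esub> a = value_coset (graph_defect f a)"
proof -
  have "\<exists>p\<in>value_coset 0. q = p + a" if "q \<in> value_coset (graph_defect f a)" for q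
    using that by (intro bexI[of _ "q - a"]) (auto simp: value_coset_iff defect_simps)
  then show ?thesis
    by (auto simp: a_r_coset_def' vspace_on_def graph_eq_value_coset value_coset_iff defect_simps)
qed

lemma carrier_L: "carrier L = lin_graph f" and add_L: "p \<oplus>\<^bsub>L\<^esub> q = p + q"
  and smult_L: "c \<odot>\<^bsub>L\<^esub> p = prod_scale sV sW c p"
  by (simp_all add: vspace_on_def)

lemma carrier_E: "carrier E = range value_coset"
proof -
  have "w \<in> range (graph_defect f)" for w
    using in_value_coset[of w] by (intro rev_image_eqI[of "(0, w)"]) (auto simp: value_coset_iff)
  then have "range (graph_defect f) = UNIV" by blast
  moreover have "carrier VW = UNIV" by (simp add: vspace_on_def)
  ultimately show ?thesis
    by (simp add: quotient_space_def A_RCOSETS_def' coset_VW UNION_singleton_eq_range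
        image_image[symmetric, of value_coset "graph_defect f"])
qed

lemma zero_E: "\<zero>\<^bsub>E\<^esub> = value_coset 0"
  by (simp add: quotient_space_def graph_eq_value_coset)

lemma add_E: "value_coset w \<oplus>\<^bsub>E\<^esub> value_coset w' = value_coset (w + w')"
proof -
  have "\<exists>p\<in>value_coset w. \<exists>q\<in>value_coset w'. r = p + q" if "r \<in> value_coset (w + w')" for r
    using that in_value_coset[of w]
    by (intro bexI[of _ "(0, w)"] bexI[of _ "r - (0, w)"]) (auto simp: value_coset_iff defect_simps)
  then show ?thesis
    by (auto simp: quotient_space_def set_add_def' vspace_on_def value_coset_iff defect_simps simp del: add_Pair)
qed

lemma smult_E: "c \<odot>\<^bsub>E\<^esub> value_coset w = value_coset (sW c w)"
proof -
  have "c \<odot>\<^bsub>E\<^esub> value_coset w = (\<Union>a\<in>value_coset w. value_coset (sW c w))"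
    unfolding quotient_space_def
    by (simp add: coset_VW) (simp add: vspace_on_def value_coset_iff defect_simps)
  then show ?thesis using in_value_coset[of w] by auto
qed

lemma rho_value_coset:
  assumes "p \<in> lin_graph f"
  shows "\<rho> p (value_coset w) = value_coset (\<nu> (f (fst p)) w)"
proof -
  have "graph_defect f (br p a) = \<nu> (f (fst p)) (graph_defect f a)" for a
    using assms by (auto simp: lin_graph_def lie_prod_def graph_defect_def f_bracket \<nu>_simps)
  then have "\<rho> p (value_coset w) = (\<Union>a\<in>value_coset w. value_coset (\<nu> (f (fst p)) w))"
    by (simp add: quotient_rep_def coset_VW value_coset_iff)
  then show ?thesis using in_value_coset[of w] by auto
qed

text \<open>
  Gives sense to the finite sums in \<open>E\<close> of the Chevalley--Eilenberg differential and to the differences in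
  the definition of a derivation.
\<close>

lemma abelian_group_E: "abelian_group E"
proof (rule abelian_groupI)
  fix x assume "x \<in> carrier E"
  then obtain w where "x = value_coset w" by (auto simp: carrier_E)
  then show "\<exists>y\<in>carrier E. y \<oplus>\<^bsub>E\<^esub> x = \<zero>\<^bsub>E\<^esub>"
    by (intro bexI[of _ "value_coset (- w)"]) (auto simp: carrier_E add_E zero_E)
qed (auto simp: carrier_E add_E zero_E value_coset_eq_iff add.commute add.left_commute)

interpretation E: abelian_group E by (rule abelian_group_E)

lemma finsum_value_coset: "finite A \<Longrightarrow> (\<Oplus>\<^bsub>E\<^esub>a\<in>A. value_coset (h a)) = value_coset (sum h A)"
proof (induction A rule: finite_induct)
  case empty
  then show ?case by (simp add: zero_E)
next
  case (insert a A)
  then show ?case by (subst E.finsum_insert) (auto simp: carrier_E add_E)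
qed

lemma bracket_in_graph: "p \<in> lin_graph f \<Longrightarrow> q \<in> lin_graph f \<Longrightarrow> br p q \<in> lin_graph f"
  by (auto simp: lin_graph_def lie_prod_def f_bracket)

lemma nth_in_graph: "xs \<in> tuples L n \<Longrightarrow> i < n \<Longrightarrow> xs ! i \<in> lin_graph f"
  using nth_mem[of i xs] unfolding tuples_def carrier_L by blast

lemma nths_drop_one_in_tuples:
  assumes "xs \<in> tuples L (Suc k)" "i \<le> k"
  shows "nths xs (- {i}) \<in> tuples L k"
proof -
  have "{j. j < Suc k \<and> j \<in> - {i}} = {..<Suc k} - {i}" by auto
  then have "length (nths xs (- {i})) = k"
    using assms by (simp add: length_nths tuples_def)
  then show ?thesis using assms set_nths_subset[of xs] by (fastforce simp: tuples_def)
qed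

lemma nths_drop_two_in_tuples:
  assumes "xs \<in> tuples L (Suc k)" "i < j" "j \<le> k"
  shows "br (xs ! i) (xs ! j) # nths xs (- {i, j}) \<in> tuples L k"
proof -
  have "{l. l < Suc k \<and> l \<in> - {i, j}} = {..<Suc k} - {i, j}" by auto
  then have "length (nths xs (- {i, j})) = k - 1"
    using assms by (simp add: length_nths tuples_def card_Diff_subset)
  moreover have "xs ! i \<in> lin_graph f" "xs ! j \<in> lin_graph f"
    using assms(2,3) by (auto intro!: nth_in_graph[OF assms(1)])
  ultimately show ?thesis using assms set_nths_subset[of xs "- {i, j}"]
    by (auto simp: tuples_def carrier_L intro!: bracket_in_graph)
qed

text \<open>
  Cochains are handled through representatives \<open>\<gamma>\<close> with values in \<open>W\<close>, so that the differential becomes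
  an ordinary sum in \<open>W\<close>.
\<close>

lemma CE_diff_value_coset:
  assumes C: "\<And>ys. ys \<in> tuples L k \<Longrightarrow> C ys = value_coset (\<gamma> ys)" and xs: "xs \<in> tuples L (Suc k)"
  shows "CE_diff L br E \<rho> k C xs = value_coset (
    (\<Sum>i\<le>k. sW ((-1) ^ i) (\<nu> (f (fst (xs ! i))) (\<gamma> (nths xs (- {i}))))) +
    (\<Sum>p\<in>{(i, j). i < j \<and> j \<le> k}. sW ((-1) ^ (fst p + snd p))
       (\<gamma> (br (xs ! fst p) (xs ! snd p) # nths xs (- {fst p, snd p})))))"
proof -
  have xsi: "xs ! i \<in> lin_graph f" if "i \<le> k" for i
    using that by (intro nth_in_graph[OF xs]) simp
  have "finite {(i, j). i < j \<and> j \<le> k}"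
    by (rule finite_subset[of _ "{..k} \<times> {..k}"]) auto
  note fin = finsum_value_coset[OF this] finsum_value_coset[OF finite_atMost[of k]]
  have 1: "(\<Oplus>\<^bsub>E\<^esub>i\<in>{..k}. (-1) ^ i \<odot>\<^bsub>E\<^esub> \<rho> (xs ! i) (C (nths xs (- {i})))) =
     (\<Oplus>\<^bsub>E\<^esub>i\<in>{..k}. value_coset (sW ((-1) ^ i) (\<nu> (f (fst (xs ! i))) (\<gamma> (nths xs (- {i}))))))"
    using xs by (intro E.finsum_cong') (auto simp: carrier_E C nths_drop_one_in_tuples rho_value_coset xsi smult_E)
  have 2: "(\<Oplus>\<^bsub>E\<^esub>p\<in>{(i, j). i < j \<and> j \<le> k}. (-1) ^ (fst p + snd p) \<odot>\<^bsub>E\<^esub>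
             C (br (xs ! fst p) (xs ! snd p) # nths xs (- {fst p, snd p}))) =
     (\<Oplus>\<^bsub>E\<^esub>p\<in>{(i, j). i < j \<and> j \<le> k}. value_coset (sW ((-1) ^ (fst p + snd p))
             (\<gamma> (br (xs ! fst p) (xs ! snd p) # nths xs (- {fst p, snd p})))))"
    using xs by (intro E.finsum_cong') (auto simp: carrier_E C nths_drop_two_in_tuples smult_E)
  show ?thesis
    using xs unfolding CE_diff_def by (simp only: restrict_apply if_True 1 2 fin add_E)
qed

lemma CE_diff_1:
  assumes C: "\<And>p. p \<in> lin_graph f \<Longrightarrow> C [p] = value_coset (\<gamma> p)"
    and pq: "p \<in> lin_graph f" "q \<in> lin_graph f"
  shows "CE_diff L br E \<rho> 1 C [p, q] =
    value_coset (\<nu> (f (fst p)) (\<gamma> q) - \<nu> (f (fst q)) (\<gamma> p) - \<gamma> (br p q))"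
proof -
  have C': "C ys = value_coset (\<gamma> (hd ys))" if "ys \<in> tuples L 1" for ys
    using that C by (auto simp: tuples_def carrier_L length_Suc_conv)
  have set: "{(i, j). i < j \<and> j \<le> 1} = {(0, 1::nat)}" by auto
  have at: "{..1} = {0, 1::nat}" by auto
  have xs: "[p, q] \<in> tuples L (Suc 1)" using pq by (simp add: tuples_def carrier_L)
  show ?thesis
    using CE_diff_value_coset[OF C' xs] unfolding set at by (simp add: nths_Cons)
qed

lemma CE_diff_2:
  assumes C: "\<And>p q. p \<in> lin_graph f \<Longrightarrow> q \<in> lin_graph f \<Longrightarrow> C [p, q] = value_coset (\<gamma> p q)"
    and pqr: "p \<in> lin_graph f" "q \<in> lin_graph f" "r \<in> lin_graph f"
  shows "CE_diff L br E \<rho> 2 C [p, q, r] =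
    value_coset (\<nu> (f (fst p)) (\<gamma> q r) - \<nu> (f (fst q)) (\<gamma> p r) + \<nu> (f (fst r)) (\<gamma> p q)
      - \<gamma> (br p q) r + \<gamma> (br p r) q - \<gamma> (br q r) p)"
proof -
  have C': "C ys = value_coset (\<gamma> (ys ! 0) (ys ! 1))" if "ys \<in> tuples L 2" for ys
    using that C by (auto simp: tuples_def carrier_L length_Suc_conv numeral_2_eq_2)
  have set: "{(i, j). i < j \<and> j \<le> 2} = {(0, 1), (0, 2), (1, 2::nat)}" by auto
  have at: "{..2} = {0, 1, 2::nat}" by auto
  have xs: "[p, q, r] \<in> tuples L (Suc 2)" using pqr by (simp add: tuples_def carrier_L)
  show ?thesis
    using CE_diff_value_coset[OF C' xs] unfolding set at by (simp add: nths_Cons algebra_simps)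
qed

lemma tuples_2_iff: "xs \<in> tuples L 2 \<longleftrightarrow> (\<exists>p\<in>lin_graph f. \<exists>q\<in>lin_graph f. xs = [p, q])"
  by (auto simp: tuples_def carrier_L length_Suc_conv numeral_2_eq_2)

lemma tuples_3_iff: "xs \<in> tuples L (Suc 2) \<longleftrightarrow>
    (\<exists>p\<in>lin_graph f. \<exists>q\<in>lin_graph f. \<exists>r\<in>lin_graph f. xs = [p, q, r])"
  by (auto simp: tuples_def carrier_L length_Suc_conv numeral_2_eq_2)

lemma graph_closed:
  "p \<in> lin_graph f \<Longrightarrow> q \<in> lin_graph f \<Longrightarrow> p + q \<in> lin_graph f"
  "p \<in> lin_graph f \<Longrightarrow> prod_scale sV sW c p \<in> lin_graph f"
  by (auto simp: lin_graph_def f_simps)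

lemma lin_maps_value_coset:
  assumes h: "Vector_Spaces.linear sV sW h" and C: "\<And>p. p \<in> lin_graph f \<Longrightarrow> C p = value_coset (h (fst p))"
  shows "(\<lambda>p\<in>carrier L. C p) \<in> lin_maps L E"
  unfolding lin_maps_def
  by (auto simp: carrier_L add_L smult_L C graph_closed carrier_E add_E smult_E linear_map_simps[OF h])

text \<open>
  Restricting to the points \<open>(x, f x)\<close> identifies linear maps from the graph to the quotient with linear
  maps from \<open>V\<close> to \<open>W\<close>.
\<close>

lemma lin_maps_E_obtain:
  assumes "C \<in> lin_maps L E"
  obtains h where "h \<in> Hom" "\<And>p. p \<in> lin_graph f \<Longrightarrow> C p = value_coset (h (fst p))"
proof -
  have g: "(x, f x) \<in> lin_graph f" for x by (auto simp: lin_graph_def)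
  have "\<exists>w. C p = value_coset w" if "p \<in> lin_graph f" for p
  proof -
    have "C p \<in> range value_coset"
      using assms that by (simp add: lin_maps_def PiE_iff carrier_L carrier_E)
    then show ?thesis by blast
  qed
  then have "\<forall>x. \<exists>w. C (x, f x) = value_coset w" using g by blast
  from choice[OF this] obtain h where h: "\<And>x. C (x, f x) = value_coset (h x)" by blast
  have add: "C (p + q) = C p \<oplus>\<^bsub>E\<^esub> C q" and scale: "C (prod_scale sV sW a p) = a \<odot>\<^bsub>E\<^esub> C p"
    if "p \<in> lin_graph f" "q \<in> lin_graph f" for p q a
    using assms that graph_closed by (auto simp: lin_maps_def carrier_L add_L smult_L)
  have "h (x + y) = h x + h y" for x y
    using add[OF g[of x] g[of y]] h[of "x + y"] by (simp add: h add_E value_coset_eq_iff f_simps)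
  moreover have "h (sV a x) = sW a (h x)" for a x
    using scale[OF g[of x] g[of x], of a] h[of "sV a x"] by (simp add: h smult_E value_coset_eq_iff f_simps)
  ultimately have "h \<in> Hom" using vs by (simp add: Hom_iff Vector_Spaces.linear_iff)
  then show ?thesis using h that[of h] by (auto simp: lin_graph_def)
qed

definition cochain :: "('v \<Rightarrow> 'v \<Rightarrow> 'w) \<Rightarrow> ('v \<times> 'w) list \<Rightarrow> ('v \<times> 'w) set" where
  "cochain c = (\<lambda>xs\<in>tuples L 2. value_coset (c (fst (xs ! 0)) (fst (xs ! 1))))"

lemma cochain_apply: "p \<in> lin_graph f \<Longrightarrow> q \<in> lin_graph f \<Longrightarrow> cochain c [p, q] = value_coset (c (fst p) (fst q))"
  by (auto simp: cochain_def tuples_2_iff)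

lemma cochain_in:
  assumes c: "c \<in> Alt"
  shows "cochain c \<in> CE_cochains L E 2"
proof -
  have c': "Vector_Spaces.linear sV sW (c x)" "Vector_Spaces.linear sV sW (\<lambda>x. c x y)" "c x x = 0" for x y
    using c by (auto simp: Alt_def Bil_iff)
  have "(\<lambda>x\<in>carrier L. cochain c (xs[i := x])) \<in> lin_maps L E" if xs: "xs \<in> tuples L 2" and i: "i < 2" for xs i
  proof -
    obtain p q where pq: "p \<in> lin_graph f" "q \<in> lin_graph f" "xs = [p, q]"
      using xs by (auto simp: tuples_2_iff)
    have "i = 0 \<or> i = 1" using i by auto
    then show ?thesis
    proof
      assume "i = 0" then show ?thesis
        by (intro lin_maps_value_coset[OF c'(2)[of "fst q"]]) (simp add: pq cochain_apply)
    next
      assume "i = 1" then show ?thesis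
        by (intro lin_maps_value_coset[OF c'(1)[of "fst p"]]) (simp add: pq cochain_apply)
    qed
  qed
  moreover have "cochain c xs = \<zero>\<^bsub>E\<^esub>"
    if "xs \<in> tuples L 2" "i < j" "j < 2" "xs ! i = xs ! j" for xs i j
  proof -
    have "i = 0" "j = 1" using that by linarith+
    then have "xs ! 0 = xs ! 1" using that(4) by simp
    then show ?thesis using that(1) by (simp only: cochain_def zero_E c' restrict_apply if_True)
  qed
  moreover have "cochain c \<in> tuples L 2 \<rightarrow>\<^sub>E carrier E"
    by (auto simp: cochain_def carrier_E)
  ultimately show ?thesis unfolding CE_cochains_def by blast
qed

lemma cochain_cocycle:
  assumes c: "c \<in> Alt" and d: "d2 c = 0"
  shows "cochain c \<in> CE_cocycles L br E \<rho> 2"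
proof -
  have c': "Vector_Spaces.linear sV sW (c x)" "Vector_Spaces.linear sV sW (\<lambda>x. c x y)" "c x x = 0" for x y
    using c by (auto simp: Alt_def Bil_iff)
  have skew: "c y x = - c x y" for x y
    by (rule alternating_skew) (simp_all add: linear_map_simps(1)[OF c'(1)] linear_map_simps(1)[OF c'(2)] c'(3))
  have mu_skew: "\<mu> x y = - \<mu> y x" for x y by (rule alternating_skew) (auto simp: \<mu>_simps)
  have "CE_diff L br E \<rho> 2 (cochain c) xs = \<zero>\<^bsub>E\<^esub>" if xs3: "xs \<in> tuples L (Suc 2)" for xs
  proof -
    obtain p q r where pqr: "p \<in> lin_graph f" "q \<in> lin_graph f" "r \<in> lin_graph f" and xs: "xs = [p, q, r]"
      using xs3 unfolding tuples_3_iff by blast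
    let ?x = "fst p" and ?y = "fst q" and ?z = "fst r"
    have "d2 c ?x ?y ?z = 0" using d by simp
    moreover have "c (\<mu> ?x ?z) ?y = - c (\<mu> ?z ?x) ?y"
      unfolding mu_skew[of ?x ?z] by (rule linear_map_simps(3)[OF c'(2)])
    moreover have "\<nu> (f ?y) (c ?x ?z) = - \<nu> (f ?y) (c ?z ?x)"
      unfolding skew[of ?x ?z] by (simp add: \<nu>_simps)
    ultimately have "\<nu> (f ?x) (c ?y ?z) - \<nu> (f ?y) (c ?x ?z) + \<nu> (f ?z) (c ?x ?y)
      - c (\<mu> ?x ?y) ?z + c (\<mu> ?x ?z) ?y - c (\<mu> ?y ?z) ?x = 0"
      unfolding d2_def twisted_diff_def by (simp add: algebra_simps)
    then show ?thesis
      unfolding xs by (subst CE_diff_2[where \<gamma> = "\<lambda>p q. c (fst p) (fst q)"])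
        (simp_all add: cochain_apply pqr zero_E lie_prod_def)
  qed
  then have "CE_diff L br E \<rho> 2 (cochain c) = (\<lambda>xs\<in>tuples L (Suc 2). \<zero>\<^bsub>E\<^esub>)"
    by (intro ext) (auto simp: CE_diff_def)
  then show ?thesis using cochain_in[OF c] by (simp add: CE_cocycles_def)
qed

text \<open>
  A cocycle \<open>c\<close> has trivial class, so its coset modulo the coboundaries is the set of coboundaries
  itself. As the zero cochain has coboundary zero, \<open>c\<close> belongs to its own coset, hence is
  a coboundary, and evaluating the primitive at the points \<open>(x, f x)\<close> gives \<open>h\<close> with \<open>d1 h = c\<close>.
\<close>

lemma exact_of_H2_zero:
  assumes H2: "carrier (CE_cohomology L br E \<rho> 2) = {\<zero>\<^bsub>CE_cohomology L br E \<rho> 2\<^esub>}"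
    and c: "c \<in> Alt" and d: "d2 c = 0"
  shows "c \<in> d1 ` Hom"
proof -
  define B where "B = CE_coboundaries L br E \<rho> 2"
  define Z where "Z = fun_space (tuples L 2) E (CE_cocycles L br E \<rho> 2)"
  have B: "B = CE_diff L br E \<rho> 1 ` CE_cochains L E 1"
    by (simp add: B_def CE_coboundaries_def numeral_2_eq_2)
  have "cochain c \<in> carrier Z" using cochain_cocycle[OF c d] by (simp add: Z_def fun_space_def)
  then have "B +>\<^bsub>Z\<^esub> cochain c \<in> carrier (CE_cohomology L br E \<rho> 2)"
    by (auto simp: CE_cohomology_def quotient_space_def A_RCOSETS_def' B_def Z_def)
  then have coset: "B +>\<^bsub>Z\<^esub> cochain c = B"
    unfolding H2 by (simp add: CE_cohomology_def quotient_space_def B_def)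
  define \<eta>0 where "\<eta>0 = (\<lambda>xs\<in>tuples L 1. value_coset 0)"
  have \<eta>0_apply: "\<eta>0 [p] = value_coset 0" if "p \<in> lin_graph f" for p using that by (simp add: \<eta>0_def tuples_def carrier_L)
  have "(\<lambda>x\<in>carrier L. \<eta>0 (xs[i := x])) \<in> lin_maps L E" if "xs \<in> tuples L 1" "i < 1" for xs i
  proof -
    have "xs[i := x] = [x]" for x using that by (auto simp: tuples_def length_Suc_conv)
    then show ?thesis by (intro lin_maps_value_coset[OF linear_map_zero[OF vs(1,2)]]) (simp add: \<eta>0_apply)
  qed
  moreover have "\<eta>0 \<in> tuples L 1 \<rightarrow>\<^sub>E carrier E" by (auto simp: \<eta>0_def carrier_E)
  ultimately have "\<eta>0 \<in> CE_cochains L E 1" by (auto simp: CE_cochains_def)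
  then have "CE_diff L br E \<rho> 1 \<eta>0 \<oplus>\<^bsub>Z\<^esub> cochain c \<in> B +>\<^bsub>Z\<^esub> cochain c"
    unfolding B by (auto simp: a_r_coset_def')
  then obtain \<eta> where \<eta>: "\<eta> \<in> CE_cochains L E 1"
      and d\<eta>: "CE_diff L br E \<rho> 1 \<eta> = CE_diff L br E \<rho> 1 \<eta>0 \<oplus>\<^bsub>Z\<^esub> cochain c"
    unfolding coset by (auto simp: B)
  have in_t: "[(0, f 0)] \<in> tuples L 1" unfolding tuples_def carrier_L by (simp add: lin_graph_def)
  have "\<forall>xs\<in>tuples L 1. \<forall>i<1. (\<lambda>x\<in>carrier L. \<eta> (xs[i := x])) \<in> lin_maps L E"
    using \<eta> by (simp add: CE_cochains_def)
  from bspec[OF this in_t] have "(\<lambda>x\<in>carrier L. \<eta> [x]) \<in> lin_maps L E" by simp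
  then obtain h where h: "h \<in> Hom"
      and h'': "\<And>p. p \<in> lin_graph f \<Longrightarrow> (\<lambda>x\<in>carrier L. \<eta> [x]) p = value_coset (h (fst p))"
    by (rule lin_maps_E_obtain) blast
  have h': "\<eta> [p] = value_coset (h (fst p))" if "p \<in> lin_graph f" for p
    using h''[OF that] that by (simp add: carrier_L)
  have "d1 h x y = c x y" for x y
  proof -
    have g: "(x, f x) \<in> lin_graph f" for x by (auto simp: lin_graph_def)
    have in_t: "[(x, f x), (y, f y)] \<in> tuples L 2" using g by (auto simp: tuples_2_iff)
    have "CE_diff L br E \<rho> 1 \<eta> [(x, f x), (y, f y)] = value_coset (d1 h x y)"
    proof -
      have "\<nu> (h x) (f y) = - \<nu> (f y) (h x)" by (rule alternating_skew) (auto simp: \<nu>_simps)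
      then show ?thesis
        by (subst CE_diff_1[where C = \<eta> and \<gamma> = "\<lambda>p. h (fst p)", OF h' g g]) (simp_all add: d1_def lie_prod_def)
    qed
    moreover have "CE_diff L br E \<rho> 1 \<eta>0 [(x, f x), (y, f y)] = value_coset 0"
      by (subst CE_diff_1[where C = \<eta>0 and \<gamma> = "\<lambda>_. 0", OF \<eta>0_apply g g]) (simp_all add: \<nu>_simps)
    ultimately have "value_coset (d1 h x y) = value_coset 0 \<oplus>\<^bsub>E\<^esub> value_coset (c x y)"
      using fun_cong[OF d\<eta>, of "[(x, f x), (y, f y)]"] in_t g
      by (simp add: Z_def fun_space_def cochain_apply)
    then show ?thesis by (simp add: add_E value_coset_eq_iff)
  qed
  then have "c = d1 h" by (simp add: fun_eq_iff)
  then show ?thesis using h by blast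
qed

lemma minus_E: "value_coset w \<ominus>\<^bsub>E\<^esub> value_coset w' = value_coset (w - w')"
proof -
  have "\<ominus>\<^bsub>E\<^esub> value_coset w' = value_coset (- w')"
    by (rule E.minus_equality) (auto simp: carrier_E add_E zero_E)
  then show ?thesis by (simp add: a_minus_def add_E)
qed

definition derivation_of :: "('v \<Rightarrow> 'w) \<Rightarrow> 'v \<times> 'w \<Rightarrow> ('v \<times> 'w) set" where
  "derivation_of h = (\<lambda>p\<in>lin_graph f. value_coset (h (fst p)))"

text \<open>
  Derivations are the 1-cocycles. This description makes it evident that the space of derivations is
  closed under its operations, hence open in its own topology.
\<close>

lemma carrier_Der: "carrier (Der_space L br E \<rho>) = derivation_of ` {h \<in> Hom. d1 h = 0}"
proof -
  have skew: "\<nu> x y = - \<nu> y x" for x y by (rule alternating_skew) (auto simp: \<nu>_simps)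
  have der_iff: "(\<forall>x\<in>lin_graph f. \<forall>y\<in>lin_graph f. C (br x y) = \<rho> x (C y) \<ominus>\<^bsub>E\<^esub> \<rho> y (C x)) \<longleftrightarrow> d1 h = 0"
    if C: "\<And>p. p \<in> lin_graph f \<Longrightarrow> C p = value_coset (h (fst p))" for C h
  proof -
    have "C (br p q) = \<rho> p (C q) \<ominus>\<^bsub>E\<^esub> \<rho> q (C p) \<longleftrightarrow> d1 h (fst p) (fst q) = 0"
      if "p \<in> lin_graph f" "q \<in> lin_graph f" for p q
    proof -
      have "fst (br p q) = \<mu> (fst p) (fst q)" by (simp add: lie_prod_def)
      then show ?thesis
        using that skew[of "h (fst p)" "f (fst q)"] C[OF bracket_in_graph[OF that]]
        by (auto simp: C rho_value_coset minus_E value_coset_eq_iff d1_def)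
    qed
    then show ?thesis by (auto simp: fun_eq_iff lin_graph_def)
  qed
  show ?thesis
  proof (intro equalityI subsetI)
    fix C assume "C \<in> carrier (Der_space L br E \<rho>)"
    then have C: "C \<in> lin_maps L E"
      and der: "\<forall>x\<in>lin_graph f. \<forall>y\<in>lin_graph f. C (br x y) = \<rho> x (C y) \<ominus>\<^bsub>E\<^esub> \<rho> y (C x)"
      by (simp_all add: Der_space_def fun_space_def carrier_L)
    obtain h where h: "h \<in> Hom" "\<And>p. p \<in> lin_graph f \<Longrightarrow> C p = value_coset (h (fst p))"
      using C by (rule lin_maps_E_obtain) blast
    have "C \<in> extensional (lin_graph f)" using C by (simp add: lin_maps_def carrier_L PiE_def)
    then have "C = derivation_of h"
      by (intro extensionalityI[of _ "lin_graph f"]) (auto simp: derivation_of_def h)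
    then show "C \<in> derivation_of ` {h \<in> Hom. d1 h = 0}" using der_iff[where C = C and h = h, OF h(2)] der h(1) by blast
  next
    fix C assume "C \<in> derivation_of ` {h \<in> Hom. d1 h = 0}"
    then obtain h where h: "h \<in> Hom" "d1 h = 0" and C: "C = derivation_of h" by blast
    have C': "C p = value_coset (h (fst p))" if "p \<in> lin_graph f" for p
      using that by (simp add: C derivation_of_def)
    have "(\<lambda>p\<in>carrier L. C p) \<in> lin_maps L E"
      using h(1) C' by (intro lin_maps_value_coset) (simp_all add: Hom_iff)
    moreover have "(\<lambda>p\<in>carrier L. C p) = C"
      unfolding carrier_L C derivation_of_def by (rule restrict_ext) simp
    ultimately show "C \<in> carrier (Der_space L br E \<rho>)"
      using der_iff[where C = C and h = h, OF C'] h(2) by (simp add: Der_space_def fun_space_def carrier_L)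
  qed
qed

section \<open>Stability of the graph\<close>

lemma carrier_Hom_space:
  "carrier (Hom_space (vspace_on sV UNIV) (vspace_on sW UNIV)) = Hom"
  using vs(1,2)
  by (auto simp: Hom_space_def fun_space_def lin_maps_def vspace_on_def Hom_iff Vector_Spaces.linear_iff)

lemma openin_Der: "openin (vs_topology (Der_space L br E \<rho>)) (carrier (Der_space L br E \<rho>))"
proof -
  have "derivation_of h \<oplus>\<^bsub>Der_space L br E \<rho>\<^esub> derivation_of h' = derivation_of (h + h')"
    "c \<odot>\<^bsub>Der_space L br E \<rho>\<^esub> derivation_of h = derivation_of (fun_scale sW c h)" for h h' c
    by (simp_all add: Der_space_def fun_space_def derivation_of_def carrier_L)
      (intro restrict_ext; simp add: add_E smult_E fun_scale_def)+
  moreover have "h + h' \<in> Hom" "fun_scale sW c h \<in> Hom" if "h \<in> Hom" "h' \<in> Hom" for h h' c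
    using that linear_map_add[of sV sW h h'] linear_map_scale[of sV sW h c]
    by (simp_all add: Hom_iff plus_fun_def fun_scale_def)
  moreover have "d1 (h + h') = 0" "d1 (fun_scale sW c h) = 0" if "d1 h = 0" "d1 h' = 0" for h h' c
  proof -
    interpret F2: vector_space "fun_scale (fun_scale sW)" by (rule fs2)
    show "d1 (h + h') = 0" "d1 (fun_scale sW c h) = 0"
      using that by (simp_all add: linear_map_simps[OF linear_d1])
  qed
  ultimately show ?thesis
    by (intro openin_vs_topology_carrier) (auto simp: carrier_Der)
qed

lemma zero_Der: "\<zero>\<^bsub>Der_space L br E \<rho>\<^esub> \<in> carrier (Der_space L br E \<rho>)"
proof -
  have "\<zero>\<^bsub>Der_space L br E \<rho>\<^esub> = derivation_of 0"
    by (auto simp: Der_space_def fun_space_def derivation_of_def carrier_L zero_E)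
  moreover have "(0 :: 'v \<Rightarrow> 'w) \<in> Hom" "d1 0 = 0"
    using linear_map_zero[OF vs(1,2)] linear_map_simps(4)[OF linear_d1] by (simp_all add: Hom_iff zero_fun_def)
  ultimately show ?thesis by (simp add: carrier_Der)
qed

lemma lie_prod_in: "lie_prod \<mu> \<nu> \<in> lie_structures (prod_scale sV sW)"
  using lie_prod_alt_bilinear \<mu> \<nu>
  by (simp add: lie_structures_def lie_prod_def zero_prod_def)

text \<open>
  The open set \<open>U\<close> bounds the finitely many structure constants of \<open>M - \<mu> \<oplus> \<nu>\<close>, which bounds
  this difference as a bilinear map; the added \<open>1\<close> in the denominator of \<open>\<delta>'\<close> avoids a division by \<open>0\<close>.
\<close>

theorem nearby_subalgebras:
  assumes H2: "carrier (CE_cohomology L br E \<rho> 2) = {\<zero>\<^bsub>CE_cohomology L br E \<rho> 2\<^esub>}"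
    and N: "openin (vs_topology (Hom_space (vspace_on sV UNIV) (vspace_on sW UNIV))) N" "f \<in> N"
  shows "\<exists>U. openin (lie_topology (prod_scale sV sW)) U \<and> lie_prod \<mu> \<nu> \<in> U \<and>
    (\<forall>M\<in>U. \<exists>g\<in>N. Vector_Spaces.linear sV sW g \<and> lie_subalgebra (prod_scale sV sW) M (lin_graph g))"
proof -
  obtain \<alpha> e' where c: "coordinates (fun_scale sW) Hom (I \<times> J) \<alpha> e'" and n1: "coord_norm (I \<times> J) \<alpha> = n1"
    using coordinates_Hom by blast
  have "\<exists>\<epsilon>>0. \<forall>h\<in>Hom. n1 h < \<epsilon> \<longrightarrow> f + h \<in> N"
    using vs_topology_contains_coord_ball[OF c carrier_Hom_space _ _ N]
    by (auto simp: n1 Hom_space_def fun_space_def vspace_on_def fun_eq_iff fun_scale_def)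
  then obtain \<epsilon> where \<epsilon>: "\<epsilon> > 0" "\<And>h. h \<in> Hom \<Longrightarrow> n1 h < \<epsilon> \<Longrightarrow> f + h \<in> N" by blast
  obtain \<delta> where \<delta>: "\<delta> > 0" and def: "\<And>M. M \<in> lie_structures (prod_scale sV sW) \<Longrightarrow>
      (\<And>p q. nP ((M - lie_prod \<mu> \<nu>) p q) \<le> \<delta> * nP p * nP q) \<Longrightarrow>
      \<exists>h\<in>Hom. n1 h < \<epsilon> \<and> lie_subalgebra (prod_scale sV sW) M (lin_graph (f + h))"
    using deformation_exists[OF exact_of_H2_zero[OF H2] \<epsilon>(1)] by meson

  define K where "K = I <+> J"
  define \<gamma> where "\<gamma> = (\<lambda>k (p :: 'v \<times> 'w). case k of Inl i \<Rightarrow> \<xi> i (fst p) | Inr j \<Rightarrow> \<eta> j (snd p))"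
  define d where "d = (\<lambda>k. case k of Inl i \<Rightarrow> (b i, 0) | Inr j \<Rightarrow> (0, e j))"
  have P: "coordinates (prod_scale sV sW) UNIV K \<gamma> d"
    unfolding K_def \<gamma>_def d_def by (rule coordinates_prod) unfold_locales
  interpret P: coordinates "prod_scale sV sW" UNIV K \<gamma> d by (rule P)
  have nP: "coord_norm K \<gamma> p = nP p" for p
    unfolding K_def \<gamma>_def by (rule coord_norm_prod[OF V.finite_index W.finite_index])
  define n where "n = real (card K)"
  define \<delta>' where "\<delta>' = \<delta> / (n * (n * n) + 1)"
  have n: "0 \<le> n" by (simp add: n_def)
  have "n * (n * n) * \<delta>' \<le> (n * (n * n) + 1) * \<delta>'"
    using n \<delta> by (intro mult_right_mono) (simp_all add: \<delta>'_def)
  also have "\<dots> = \<delta>" using n by (simp add: \<delta>'_def add_nonneg_eq_0_iff)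
  finally have \<delta>': "\<delta>' > 0" "n * (n * (n * \<delta>')) \<le> \<delta>"
    using \<delta> n by (simp_all add: \<delta>'_def add_nonneg_pos mult.assoc)
  define U where "U = {M \<in> lie_structures (prod_scale sV sW).
    \<forall>i\<in>K. \<forall>j\<in>K. \<forall>k\<in>K. norm (\<gamma> k (M (d i) (d j)) - \<gamma> k (lie_prod \<mu> \<nu> (d i) (d j))) < \<delta>'}"
  have "openin (lie_topology (prod_scale sV sW)) U"
    unfolding U_def by (rule openin_lie_topology_coord_ball[OF P])
  moreover have "lie_prod \<mu> \<nu> \<in> U" using lie_prod_in \<delta>'(1) by (simp add: U_def)
  moreover have "\<exists>g\<in>N. Vector_Spaces.linear sV sW g \<and> lie_subalgebra (prod_scale sV sW) M (lin_graph g)"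
    if M: "M \<in> U" for M
  proof -
    have M_lie: "M \<in> lie_structures (prod_scale sV sW)" using M by (simp add: U_def)
    define m where "m = M - lie_prod \<mu> \<nu>"
    have m: "m \<in> alt_bilinear (prod_scale sV sW)"
      unfolding m_def using M_lie by (intro alt_bilinear_diff lie_prod_alt_bilinear) (simp add: lie_structures_def)
    have "norm (\<gamma> k (m (d i) (d j))) \<le> \<delta>'" if "i \<in> K" "j \<in> K" "k \<in> K" for i j k
      using M that by (auto simp: U_def m_def P.coord_diff intro: less_imp_le)
    then have "coord_norm K \<gamma> (m (d i) (d j)) \<le> n * \<delta>'" if "i \<in> K" "j \<in> K" for i j
      unfolding coord_norm_def n_def using that by (intro sum_bounded_above) auto
    then have "lin_norm K d (coord_norm K \<gamma>) (m (d i)) \<le> n * (n * \<delta>')" if "i \<in> K" for i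
      unfolding lin_norm_def n_def using that by (intro sum_bounded_above) auto
    then have "lin_norm K d (lin_norm K d (coord_norm K \<gamma>)) m \<le> n * (n * (n * \<delta>'))"
      unfolding lin_norm_def[of K d "lin_norm K d (coord_norm K \<gamma>)"] n_def by (intro sum_bounded_above) auto
    then have m_norm: "lin_norm K d (lin_norm K d (coord_norm K \<gamma>)) m \<le> \<delta>" using \<delta>'(2) by linarith
    have m_le: "nP (m p q) \<le> \<delta> * nP p * nP q" for p q
    proof -
      have "coord_norm K \<gamma> (m p q) \<le>
          lin_norm K d (lin_norm K d (coord_norm K \<gamma>)) m * coord_norm K \<gamma> p * coord_norm K \<gamma> q"
        using m by (intro bilinear_le_lin_norm[OF P P.seminorm_coord_norm])
          (simp_all add: alt_bilinear_def del: split_paired_All)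
      also have "\<dots> \<le> \<delta> * coord_norm K \<gamma> p * coord_norm K \<gamma> q"
        by (intro mult_right_mono m_norm seminorm_nonneg[OF P.seminorm_coord_norm])
      finally show ?thesis unfolding nP .
    qed
    obtain h where h: "h \<in> Hom" "n1 h < \<epsilon>" "lie_subalgebra (prod_scale sV sW) M (lin_graph (f + h))"
      using def[OF M_lie m_le[unfolded m_def]] by blast
    have "Vector_Spaces.linear sV sW (f + h)"
      using linear_map_add[OF f_linear, of h] h(1) by (simp add: Hom_iff plus_fun_def)
    then show ?thesis using \<epsilon>(2)[OF h(1,2)] h(3) by blast
  qed
  ultimately show ?thesis by blast
qed

end

theorem theorem3p22:
  fixes sV :: "'k::{real_normed_field, euclidean_space} \<Rightarrow> 'v::ab_group_add \<Rightarrow> 'v"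
    and sW :: "'k \<Rightarrow> 'w::ab_group_add \<Rightarrow> 'w"
    and BV :: "'v set" and BW :: "'w set"
    and \<mu> :: "'v \<Rightarrow> 'v \<Rightarrow> 'v" and \<nu> :: "'w \<Rightarrow> 'w \<Rightarrow> 'w"
    and f :: "'v \<Rightarrow> 'w"
    and sVW :: "'k \<Rightarrow> 'v \<times> 'w \<Rightarrow> 'v \<times> 'w"
    and VW :: "('k, 'v \<times> 'w) module"
    and L :: "('k, 'v \<times> 'w) module"
    and E :: "('k, ('v \<times> 'w) set) module"
    and \<rho> :: "'v \<times> 'w \<Rightarrow> ('v \<times> 'w) set \<Rightarrow> ('v \<times> 'w) set"
  defines "sVW \<equiv> module_prod.scale sV sW"
    and "VW \<equiv> vspace_on sVW UNIV"
    and "L \<equiv> vspace_on sVW (lin_graph f)"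
    and "E \<equiv> quotient_space VW (lin_graph f)"
    and "\<rho> \<equiv> quotient_rep VW (lie_prod \<mu> \<nu>) (lin_graph f)"
  assumes V: "finite_dimensional_vector_space sV BV"
    and W: "finite_dimensional_vector_space sW BW"
    and \<mu>: "\<mu> \<in> lie_structures sV"
    and \<nu>: "\<nu> \<in> lie_structures sW"
    and f: "lie_morphism sV sW \<mu> \<nu> f"
    and H2: "carrier (CE_cohomology L (lie_prod \<mu> \<nu>) E \<rho> 2)
               = {\<zero>\<^bsub>CE_cohomology L (lie_prod \<mu> \<nu>) E \<rho> 2\<^esub>}"
  shows "\<forall>N. openin (vs_topology (Hom_space (vspace_on sV UNIV) (vspace_on sW UNIV))) N \<and> f \<in> N \<longrightarrow>
    (\<exists>U. openin (lie_topology sVW) U \<and> lie_prod \<mu> \<nu> \<in> U \<and>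
      (\<forall>M\<in>U. \<exists>Om F.
         openin (vs_topology (Der_space L (lie_prod \<mu> \<nu>) E \<rho>)) Om \<and>
         \<zero>\<^bsub>Der_space L (lie_prod \<mu> \<nu>) E \<rho>\<^esub> \<in> Om \<and>
         F \<in> Om \<rightarrow> N \<and>
         (\<forall>\<delta>\<in>Om. lie_subalgebra sVW M (lin_graph (F \<delta>))) \<and>
         (\<forall>\<mu>'\<in>lie_structures sV. \<forall>\<nu>'\<in>lie_structures sW. M = lie_prod \<mu>' \<nu>' \<longrightarrow>
            (\<forall>\<delta>\<in>Om. lie_morphism sV sW \<mu>' \<nu>' (F \<delta>)))))"
proof -
  interpret V: finite_dimensional_vector_space sV BV by (rule V)
  interpret W: finite_dimensional_vector_space sW BW by (rule W)
  have scale: "sVW = prod_scale sV sW"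
    unfolding sVW_def by (rule module_prod_scale_eq) unfold_locales
  interpret lie_morphism_coordinates sV BV "\<lambda>v x. V.representation BV x v" "\<lambda>v. v"
    sW BW "\<lambda>w x. W.representation BW x w" "\<lambda>w. w" \<mu> \<nu> f
    by (intro lie_morphism_coordinates.intro lie_morphism_coordinates_axioms.intro
        coordinates_basis V W \<mu> \<nu> f)
  note unfold = L_def E_def \<rho>_def VW_def scale
  show ?thesis
  proof (intro allI impI, elim conjE)
    fix N assume N: "openin (vs_topology (Hom_space (vspace_on sV UNIV) (vspace_on sW UNIV))) N" "f \<in> N"
    obtain U where U: "openin (lie_topology sVW) U" "lie_prod \<mu> \<nu> \<in> U"
      and sub: "\<And>M. M \<in> U \<Longrightarrow> \<exists>g\<in>N. Vector_Spaces.linear sV sW g \<and> lie_subalgebra sVW M (lin_graph g)"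
      using nearby_subalgebras[OF H2[unfolded unfold] N] unfolding scale by blast
    have "\<exists>Om F. openin (vs_topology (Der_space L (lie_prod \<mu> \<nu>) E \<rho>)) Om \<and>
         \<zero>\<^bsub>Der_space L (lie_prod \<mu> \<nu>) E \<rho>\<^esub> \<in> Om \<and>
         F \<in> Om \<rightarrow> N \<and>
         (\<forall>\<delta>\<in>Om. lie_subalgebra sVW M (lin_graph (F \<delta>))) \<and>
         (\<forall>\<mu>'\<in>lie_structures sV. \<forall>\<nu>'\<in>lie_structures sW. M = lie_prod \<mu>' \<nu>' \<longrightarrow>
            (\<forall>\<delta>\<in>Om. lie_morphism sV sW \<mu>' \<nu>' (F \<delta>)))" if M: "M \<in> U" for M
    proof -
      obtain g where g: "g \<in> N" "Vector_Spaces.linear sV sW g" "lie_subalgebra sVW M (lin_graph g)"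
        using sub[OF M] by blast
      show ?thesis
        by (rule exI[of _ "carrier (Der_space L (lie_prod \<mu> \<nu>) E \<rho>)"], rule exI[of _ "\<lambda>_. g"])
          (use g openin_Der zero_Der lie_morphism_of_subalgebra in \<open>auto simp: unfold\<close>)
    qed
    then show "\<exists>U. openin (lie_topology sVW) U \<and> lie_prod \<mu> \<nu> \<in> U \<and>
      (\<forall>M\<in>U. \<exists>Om F.
         openin (vs_topology (Der_space L (lie_prod \<mu> \<nu>) E \<rho>)) Om \<and>
         \<zero>\<^bsub>Der_space L (lie_prod \<mu> \<nu>) E \<rho>\<^esub> \<in> Om \<and>
         F \<in> Om \<rightarrow> N \<and>
         (\<forall>\<delta>\<in>Om. lie_subalgebra sVW M (lin_graph (F \<delta>))) \<and>
         (\<forall>\<mu>'\<in>lie_structures sV. \<forall>\<nu>'\<in>lie_structures sW. M = lie_prod \<mu>' \<nu>' \<longrightarrow>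
            (\<forall>\<delta>\<in>Om. lie_morphism sV sW \<mu>' \<nu>' (F \<delta>))))"
      using U by blast
  qed
qed

end
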